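(* Let $\mathcal H$ be a separable infinite-dimensional complex Hilbert space, let $T$ be a compact operator on $\mathcal H$ that is not trace class, and let $0<\theta<1$. Then there is a bounded invertible operator $S$ on $\mathcal H$ such that $$\|S\|\leq 1+2\theta,\qquad \|S^{-1}\|\leq 1+2\theta,$$ and $S^{-1}TS$ has a zero-diagonal.
   Context: An operator $R\in\mathcal B(\mathcal H)$ has a zero-diagonal if there exists an orthonormal basis $(e_j)$ of $\mathcal H$ such that $\langle Re_j,e_j\rangle=0$ for all $j$. An operator $R\in\mathcal B(\mathcal H)$ is trace class if $\sum_j\langle |R|e_j,e_j\rangle<\infty$ for an orthonormal basis $(e_j)$, where $|R|=(R^*R)^{1/2}$. Norms are operator norms. *)

theory Defs
  imports "HOL-Analysis.Analysis"
begin

class complex_vector = real_vector +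
  fixes scaleC :: "complex \<Rightarrow> 'a \<Rightarrow> 'a" (infixr "*\<^sub>C" 75)
  assumes scaleC_add_right: "a *\<^sub>C (x + y) = a *\<^sub>C x + a *\<^sub>C y"
    and scaleC_add_left: "(a + b) *\<^sub>C x = a *\<^sub>C x + b *\<^sub>C x"
    and scaleC_scaleC: "a *\<^sub>C (b *\<^sub>C x) = (a * b) *\<^sub>C x"
    and scaleC_one: "1 *\<^sub>C x = x"
    and scaleR_scaleC: "r *\<^sub>R x = complex_of_real r *\<^sub>C x"

global_interpretation complex_vector: vector_space "scaleC :: complex \<Rightarrow> 'a \<Rightarrow> 'a::complex_vector"
  defines cspan = complex_vector.span
  by standard (simp_all add: scaleC_add_right scaleC_add_left scaleC_scaleC scaleC_one)

text \<open>The complex inner product is linear in its first argument. The library's real inner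
  product (and with it the norm and the topology) is tied to it as its real part, so that
  \<open>cinner x x = (norm x)\<^sup>2\<close>; conjugate symmetry makes \<open>cinner x x\<close> real.\<close>

class complex_inner = complex_vector + real_inner +
  fixes cinner :: "'a \<Rightarrow> 'a \<Rightarrow> complex"
  assumes cinner_commute: "cinner x y = cnj (cinner y x)"
    and cinner_add_left: "cinner (x + y) z = cinner x z + cinner y z"
    and cinner_scaleC_left: "cinner (c *\<^sub>C x) y = c * cinner x y"
    and inner_eq_Re_cinner: "inner x y = Re (cinner x y)"

class complex_hilbert_space = complex_inner + complete_space

lemma cinner_self_eq_norm:
  fixes x :: "'a::complex_inner"
  shows "cinner x x = complex_of_real ((norm x)\<^sup>2)"
proof (rule complex_eqI)
  show "Re (cinner x x) = Re (complex_of_real ((norm x)\<^sup>2))"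
    by (simp add: power2_norm_eq_inner inner_eq_Re_cinner del: of_real_power)
  have "Im (cinner x x) = Im (cnj (cinner x x))"
    using cinner_commute[of x x] by (rule arg_cong)
  then show "Im (cinner x x) = Im (complex_of_real ((norm x)\<^sup>2))"
    by (simp del: of_real_power)
qed

definition bounded_clinear :: "('a::complex_inner \<Rightarrow> 'b::complex_inner) \<Rightarrow> bool" where
  "bounded_clinear T \<longleftrightarrow> bounded_linear T \<and> (\<forall>c x. T (c *\<^sub>C x) = c *\<^sub>C T x)"

definition compact_operator :: "('a::complex_inner \<Rightarrow> 'b::complex_inner) \<Rightarrow> bool" where
  "compact_operator T \<longleftrightarrow> bounded_clinear T \<and> compact (closure (T ` cball 0 1))"

text \<open>An orthonormal basis is given as the set of its vectors, which allows any Hilbert dimension.\<close>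

definition orthonormal_basis :: "'a::complex_inner set \<Rightarrow> bool" where
  "orthonormal_basis B \<longleftrightarrow>
     (\<forall>e\<in>B. \<forall>f\<in>B. cinner e f = (if e = f then 1 else 0)) \<and> closure (cspan B) = UNIV"

definition zero_diagonal :: "('a::complex_inner \<Rightarrow> 'a) \<Rightarrow> bool" where
  "zero_diagonal R \<longleftrightarrow> (\<exists>B. orthonormal_basis B \<and> (\<forall>e\<in>B. cinner (R e) e = 0))"

text \<open>For a bounded operator on a Hilbert space both descriptions below have exactly one solution,
  by the Riesz representation theorem and the existence and uniqueness of positive square roots.
  A complex operator with \<open>cinner (P x) x \<in> \<real>\<^sub>\<ge>\<^sub>0\<close> for all \<open>x\<close> is
  automatically self-adjoint.\<close>

definition cadjoint :: "('a::complex_inner \<Rightarrow> 'b::complex_inner) \<Rightarrow> 'b \<Rightarrow> 'a" where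
  "cadjoint T = (THE T'. \<forall>x y. cinner (T x) y = cinner x (T' y))"

definition positive_operator :: "('a::complex_inner \<Rightarrow> 'a) \<Rightarrow> bool" where
  "positive_operator P \<longleftrightarrow> bounded_clinear P \<and> (\<forall>x. cinner (P x) x \<in> \<real>\<^sub>\<ge>\<^sub>0)"

definition abs_operator :: "('a::complex_inner \<Rightarrow> 'b::complex_inner) \<Rightarrow> 'a \<Rightarrow> 'a" where
  "abs_operator T = (THE P. positive_operator P \<and> P \<circ> P = cadjoint T \<circ> T)"

definition trace_class :: "('a::complex_inner \<Rightarrow> 'a) \<Rightarrow> bool" where
  "trace_class R \<longleftrightarrow> bounded_clinear R \<and>
     (\<exists>B. orthonormal_basis B \<and> (\<lambda>e. cinner (abs_operator R e) e) summable_on B)"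

end

theory Submission
  imports Defs
begin

text \<open>If \<open>u\<^sub>j, v\<^sub>j\<close> are jointly orthonormal, \<open>N = \<Sum>\<^sub>j c\<^sub>j \<langle>\<sqdot>, v\<^sub>j\<rangle> u\<^sub>j\<close> has \<open>N\<^sup>2 = 0\<close>, and conjugating
  \<open>T\<close> by \<open>S = 1 + N\<close> moves the diagonal entry at \<open>v\<^sub>j\<close> by \<open>c\<^sub>j \<langle>T u\<^sub>j, v\<^sub>j\<rangle>\<close> and changes no other entry of an
  orthonormal basis except the one at \<open>u\<^sub>j\<close>. With \<open>\<bar>c\<^sub>j\<bar> \<le> \<theta>\<close> the entry at \<open>v\<^sub>j\<close> can be given any value of modulus at
  most \<open>\<rho>\<^sub>j = \<theta> \<bar>\<langle>T u\<^sub>j, v\<^sub>j\<rangle>\<bar> - \<bar>\<langle>T v\<^sub>j, v\<^sub>j\<rangle>\<bar>\<close>. If \<open>\<Sum>\<^sub>j \<rho>\<^sub>j = \<infinity>\<close>, the basis splits into finite blocks, each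
  consisting of one vector with diagonal entry \<open>\<alpha>\<close> and of vectors \<open>v\<^sub>j\<close> with entries \<open>- t\<^sub>j \<alpha>\<close>, where
  \<open>t\<^sub>j \<ge> 0\<close> and \<open>\<Sum> t\<^sub>j = 1\<close>; rotations inside the block then make its diagonal zero.

  As \<open>T\<close> is not trace class, the eigenvalues of \<open>T + T\<^sup>*\<close> or of \<open>\<i>(T - T\<^sup>*)\<close> are not absolutely summable, so
  \<open>\<Sum>\<^sub>j \<bar>\<langle>T g\<^sub>j, g\<^sub>j\<rangle>\<bar> = \<infinity>\<close> for an orthonormal sequence \<open>g\<close>; suitable \<open>u\<^sub>j, v\<^sub>j\<close> arise by rotating some of the
  \<open>g\<^sub>j\<close> slightly towards others on which \<open>T\<close> is tiny.\<close>

subsection \<open>Complex inner products\<close>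

instance complex_hilbert_space \<subseteq> banach ..

lemma cinner_add_right: "cinner x (y + z) = cinner x y + cinner x z"
  by (metis cinner_add_left cinner_commute complex_cnj_add)

lemma cinner_scaleC_right: "cinner x (c *\<^sub>C y) = cnj c * cinner x y"
  by (metis cinner_commute cinner_scaleC_left complex_cnj_mult)

text \<open>The norm is tied by the class to real scaling only; complex homogeneity is read off from
  \<open>cinner_self_eq_norm\<close>.\<close>

lemma norm_scaleC: "norm (c *\<^sub>C x) = cmod c * norm (x :: 'a::complex_inner)"
proof -
  have "complex_of_real ((norm (c *\<^sub>C x))\<^sup>2) = c * cnj c * cinner x x"
    by (simp add: cinner_self_eq_norm[symmetric] cinner_scaleC_left cinner_scaleC_right ac_simps
        del: of_real_power)
  also have "\<dots> = complex_of_real ((cmod c * norm x)\<^sup>2)"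
    by (simp only: cinner_self_eq_norm complex_norm_square[symmetric] power_mult_distrib of_real_mult)
  finally have "(norm (c *\<^sub>C x))\<^sup>2 = (cmod c * norm x)\<^sup>2" using of_real_eq_iff by blast
  then show ?thesis by (simp add: power2_eq_iff_nonneg)
qed

text \<open>A phase \<open>w\<close> turns the inner product into its modulus, which reduces the
  complex Cauchy-Schwarz inequality to the real one.\<close>

lemma norm_cinner_le: "cmod (cinner x y) \<le> norm x * norm (y :: 'a::complex_inner)"
proof (cases "cinner x y = 0")
  case False
  define w where "w = cnj (cinner x y) / cmod (cinner x y)"
  have w: "cmod w = 1" using False by (simp add: w_def norm_divide)
  have "inner (w *\<^sub>C x) y = Re (w * cinner x y)"
    by (simp add: inner_eq_Re_cinner cinner_scaleC_left)
  also have "w * cinner x y = complex_of_real ((cmod (cinner x y))\<^sup>2) / cmod (cinner x y)"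
    unfolding w_def complex_norm_square by (simp add: mult.commute)
  also have "\<dots> = complex_of_real (cmod (cinner x y))" by (simp add: power2_eq_square)
  finally have "cmod (cinner x y) = inner (w *\<^sub>C x) y" by simp
  also have "\<dots> \<le> norm (w *\<^sub>C x) * norm y" by (rule norm_cauchy_schwarz)
  finally show ?thesis by (simp add: norm_scaleC w)
qed simp

lemma cinner_bounded_bilinear: "bounded_bilinear (cinner :: 'a::complex_inner \<Rightarrow> 'a \<Rightarrow> complex)"
proof
  fix r :: real and a b :: 'a
  show "cinner (r *\<^sub>R a) b = r *\<^sub>R cinner a b"
    by (simp add: scaleR_scaleC cinner_scaleC_left scaleR_conv_of_real)
  show "cinner a (r *\<^sub>R b) = r *\<^sub>R cinner a b"
    by (simp add: scaleR_scaleC cinner_scaleC_right scaleR_conv_of_real)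
  show "\<exists>K. \<forall>a b :: 'a. cmod (cinner a b) \<le> norm a * norm b * K"
    by (rule exI[of _ 1]) (simp add: norm_cinner_le)
qed (rule cinner_add_left cinner_add_right)+

lemmas cinner_zero_left [simp] = bounded_bilinear.zero_left[OF cinner_bounded_bilinear]
  and cinner_zero_right [simp] = bounded_bilinear.zero_right[OF cinner_bounded_bilinear]
  and cinner_minus_left = bounded_bilinear.minus_left[OF cinner_bounded_bilinear]
  and cinner_minus_right = bounded_bilinear.minus_right[OF cinner_bounded_bilinear]
  and cinner_diff_left = bounded_bilinear.diff_left[OF cinner_bounded_bilinear]
  and cinner_diff_right = bounded_bilinear.diff_right[OF cinner_bounded_bilinear]
  and cinner_sum_left = bounded_bilinear.sum_left[OF cinner_bounded_bilinear]
  and cinner_sum_right = bounded_bilinear.sum_right[OF cinner_bounded_bilinear]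
  and tendsto_cinner = bounded_bilinear.tendsto[OF cinner_bounded_bilinear]
  and cinner_bounded_linear_left = bounded_bilinear.bounded_linear_left[OF cinner_bounded_bilinear]
  and cinner_bounded_linear_right = bounded_bilinear.bounded_linear_right[OF cinner_bounded_bilinear]

lemmas cinner_linear = cinner_add_left cinner_add_right cinner_diff_left cinner_diff_right
  cinner_minus_left cinner_minus_right cinner_scaleC_left cinner_scaleC_right

lemma cinner_eq_0_commute: "cinner x y = 0 \<longleftrightarrow> cinner y x = 0"
  by (metis cinner_commute complex_cnj_zero)

lemma cinner_self_eq_0 [simp]: "cinner x x = 0 \<longleftrightarrow> x = (0 :: 'a::complex_inner)"
  by (simp add: cinner_self_eq_norm)

lemma cinner_self_eq_1: "cinner x x = 1 \<longleftrightarrow> norm (x :: 'a::complex_inner) = 1"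
  by (metis cinner_self_eq_norm norm_ge_zero of_real_eq_1_iff power2_eq_1_iff
      zero_le_one le_minus_one_simps(3) order_trans)

lemma Re_cinner_self: "Re (cinner x x) = (norm (x :: 'a::complex_inner))\<^sup>2"
  by (simp add: cinner_self_eq_norm del: of_real_power)

lemma cinner_eqI: "(\<And>z. cinner x z = cinner y z) \<Longrightarrow> x = (y :: 'a::complex_inner)"
  by (metis cinner_diff_left cinner_self_eq_0 right_minus_eq)

lemma scaleC_zero_left [simp]: "0 *\<^sub>C x = (0 :: 'a::complex_vector)"
  by (rule complex_vector.scale_zero_left)

lemma scaleC_zero_right [simp]: "c *\<^sub>C 0 = (0 :: 'a::complex_vector)"
  by (rule complex_vector.scale_zero_right)

section \<open>Bounded complex-linear maps\<close>

lemma bounded_clinear_scaleC: "bounded_clinear T \<Longrightarrow> T (c *\<^sub>C x) = c *\<^sub>C T x"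
  by (simp add: bounded_clinear_def)

lemma bounded_clinear_bounded_linear: "bounded_clinear T \<Longrightarrow> bounded_linear T"
  by (simp add: bounded_clinear_def)

lemma scaleC_bounded_linear: "bounded_linear (\<lambda>x :: 'a::complex_inner. c *\<^sub>C x)"
  by (rule bounded_linear_intro[where K = "cmod c"])
     (simp_all add: scaleC_add_right scaleR_scaleC scaleC_scaleC norm_scaleC mult.commute)

lemma scaleC_minus_left: "(- c) *\<^sub>C x = - (c *\<^sub>C (x :: 'a::complex_vector))"
  by (rule complex_vector.scale_minus_left)

lemma bounded_clinear_ident: "bounded_clinear (\<lambda>x. x)"
  by (simp add: bounded_clinear_def bounded_linear_ident)

lemma bounded_clinear_compose:
  "bounded_clinear f \<Longrightarrow> bounded_clinear g \<Longrightarrow> bounded_clinear (\<lambda>x. f (g x))"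
  by (simp add: bounded_clinear_def bounded_linear_compose)

lemma bounded_clinear_add:
  "bounded_clinear f \<Longrightarrow> bounded_clinear g \<Longrightarrow> bounded_clinear (\<lambda>x. f x + g x)"
  by (simp add: bounded_clinear_def bounded_linear_add scaleC_add_right)

lemma bounded_clinear_scale:
  "bounded_clinear f \<Longrightarrow> bounded_clinear (\<lambda>x. c *\<^sub>C f x)"
  by (simp add: bounded_clinear_def scaleC_scaleC mult.commute
      bounded_linear_compose[OF scaleC_bounded_linear])

lemma bounded_clinear_sub:
  "bounded_clinear f \<Longrightarrow> bounded_clinear g \<Longrightarrow> bounded_clinear (\<lambda>x. f x - g x)"
  by (simp add: bounded_clinear_def bounded_linear_sub complex_vector.scale_right_diff_distrib)

subsection \<open>Orthogonal sequences\<close>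

definition subnormal_seq :: "(nat \<Rightarrow> 'a::complex_inner) \<Rightarrow> bool" where
  "subnormal_seq g \<longleftrightarrow> (\<forall>m n. m \<noteq> n \<longrightarrow> cinner (g m) (g n) = 0) \<and> (\<forall>n. norm (g n) \<le> 1)"

definition orthonormal_seq :: "(nat \<Rightarrow> 'a::complex_inner) \<Rightarrow> bool" where
  "orthonormal_seq g \<longleftrightarrow> (\<forall>m n. cinner (g m) (g n) = (if m = n then 1 else 0))"

lemma orthonormal_seq_norm: "orthonormal_seq g \<Longrightarrow> norm (g n) = 1"
  by (metis cinner_self_eq_1 orthonormal_seq_def)

lemma orthonormal_imp_subnormal_seq: "orthonormal_seq g \<Longrightarrow> subnormal_seq g"
  using orthonormal_seq_norm[of g] by (simp add: subnormal_seq_def orthonormal_seq_def)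

lemma orthonormal_seq_inj: "orthonormal_seq g \<Longrightarrow> inj g"
  by (metis injI orthonormal_seq_def zero_neq_one)

lemma orthonormal_seq_comp: "orthonormal_seq g \<Longrightarrow> inj r \<Longrightarrow> orthonormal_seq (\<lambda>n. g (r n))"
  by (auto simp: orthonormal_seq_def dest: injD)

text \<open>Pythagoras, as an inequality because the vectors may be shorter than 1.\<close>

lemma norm_orthogonal_sum_le:
  assumes "subnormal_seq g" "finite F"
  shows "(norm (\<Sum>k\<in>F. a k *\<^sub>C g k))\<^sup>2 \<le> (\<Sum>k\<in>F. (cmod (a k))\<^sup>2)"
proof -
  have *: "cinner (g k) (g l) = (if k = l then complex_of_real ((norm (g k))\<^sup>2) else 0)" for k l
    using assms(1) by (simp add: subnormal_seq_def cinner_self_eq_norm)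
  have "complex_of_real ((norm (\<Sum>k\<in>F. a k *\<^sub>C g k))\<^sup>2)
      = (\<Sum>k\<in>F. \<Sum>l\<in>F. cnj (a k) * (a l * cinner (g l) (g k)))"
    by (simp add: cinner_self_eq_norm[symmetric] cinner_sum_left cinner_sum_right cinner_scaleC_left
        cinner_scaleC_right sum_distrib_left ac_simps del: of_real_power)
  also have "\<dots> = (\<Sum>k\<in>F. complex_of_real ((cmod (a k))\<^sup>2 * (norm (g k))\<^sup>2))"
    using assms(2) by (intro sum.cong refl)
      (simp add: * if_distrib complex_norm_square[symmetric] cong: if_cong
        flip: mult.assoc of_real_mult of_real_power, simp add: mult.commute flip: complex_norm_square)
  also have "\<dots> = complex_of_real (\<Sum>k\<in>F. (cmod (a k))\<^sup>2 * (norm (g k))\<^sup>2)" by simp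
  finally have "(norm (\<Sum>k\<in>F. a k *\<^sub>C g k))\<^sup>2 = (\<Sum>k\<in>F. (cmod (a k))\<^sup>2 * (norm (g k))\<^sup>2)"
    using of_real_eq_iff by blast
  also have "\<dots> \<le> (\<Sum>k\<in>F. (cmod (a k))\<^sup>2)"
    using assms(1) by (intro sum_mono mult_left_le) (simp_all add: subnormal_seq_def power_le_one)
  finally show ?thesis .
qed

text \<open>Absorbs a square sum that a duality argument has estimated by its own root.\<close>

lemma le_of_sq_le_mult_sqrt:
  fixes b c :: real
  assumes "b \<le> c * sqrt b" "0 \<le> b" shows "b \<le> c\<^sup>2"
proof (cases "b = 0")
  case False
  then have "sqrt b * sqrt b \<le> c * sqrt b" "sqrt b > 0" using assms by auto
  then have "sqrt b \<le> c" by (meson mult_le_cancel_right_pos)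
  then have "(sqrt b)\<^sup>2 \<le> c\<^sup>2" using assms(2) by (intro power_mono) auto
  then show ?thesis using assms(2) by simp
qed simp

text \<open>Pairing \<open>x\<close> with \<open>y\<close>, the sum of its own components, gives
  \<open>b\<close>, while \<open>y\<close> has norm at most \<open>sqrt b\<close>; Cauchy-Schwarz
  closes the estimate.\<close>

lemma bessel_finite:
  assumes "subnormal_seq g" "finite F"
  shows "(\<Sum>k\<in>F. (cmod (cinner x (g k)))\<^sup>2) \<le> (norm x)\<^sup>2"
proof -
  define b where "b = (\<Sum>k\<in>F. (cmod (cinner x (g k)))\<^sup>2)"
  define y where "y = (\<Sum>k\<in>F. cinner x (g k) *\<^sub>C g k)"
  have b0: "b \<ge> 0" by (simp add: b_def sum_nonneg)
  have "(norm y)\<^sup>2 \<le> b" unfolding y_def b_def by (rule norm_orthogonal_sum_le[OF assms])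
  then have ny: "norm y \<le> sqrt b" by (rule real_le_rsqrt)
  have "cinner x y = complex_of_real b"
    by (simp add: y_def b_def cinner_sum_right cinner_scaleC_right complex_norm_square mult.commute
        del: of_real_power)
  then have "b \<le> norm x * norm y" using norm_cinner_le[of x y] b0 by simp
  also have "\<dots> \<le> norm x * sqrt b" using ny by (simp add: mult_left_mono)
  finally show ?thesis using le_of_sq_le_mult_sqrt b0 unfolding b_def by blast
qed

lemma bessel_summable: "subnormal_seq g \<Longrightarrow> summable (\<lambda>k. (cmod (cinner x (g k)))\<^sup>2)"
  by (rule bounded_imp_summable[where B = "(norm x)\<^sup>2"])
     (simp_all add: bessel_finite)

lemma cinner_orthonormal_tendsto_0:
  assumes "subnormal_seq g" shows "(\<lambda>n. cinner x (g n)) \<longlonglongrightarrow> 0"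
proof -
  have "(\<lambda>n. sqrt ((cmod (cinner x (g n)))\<^sup>2)) \<longlonglongrightarrow> sqrt 0"
    by (intro tendsto_real_sqrt summable_LIMSEQ_zero bessel_summable assms)
  then show ?thesis by (simp add: tendsto_norm_zero_iff)
qed

text \<open>Pythagoras on index intervals makes the partial sums Cauchy, and its bound on initial
  segments passes to the limit.\<close>

lemma riesz_fischer:
  fixes g :: "nat \<Rightarrow> 'a::complex_hilbert_space"
  assumes g: "subnormal_seq g" and a: "summable (\<lambda>k. (cmod (a k))\<^sup>2)"
  shows "summable (\<lambda>k. a k *\<^sub>C g k)"
    and "(norm (\<Sum>k. a k *\<^sub>C g k))\<^sup>2 \<le> (\<Sum>k. (cmod (a k))\<^sup>2)"
proof -
  have "Cauchy (\<lambda>n. \<Sum>k<n. a k *\<^sub>C g k)"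
  proof (rule CauchyI)
    fix e :: real assume e: "e > 0"
    then have "e\<^sup>2 > 0" by simp
    with a obtain N where N: "\<And>m n. m \<ge> N \<Longrightarrow> norm (\<Sum>k\<in>{m..<n}. (cmod (a k))\<^sup>2) < e\<^sup>2"
      unfolding summable_Cauchy by meson
    have le: "norm ((\<Sum>k<n. a k *\<^sub>C g k) - (\<Sum>k<m. a k *\<^sub>C g k)) < e" if "m \<ge> N" "m \<le> n" for m n
    proof -
      have "(\<Sum>k<n. a k *\<^sub>C g k) - (\<Sum>k<m. a k *\<^sub>C g k) = (\<Sum>k\<in>{m..<n}. a k *\<^sub>C g k)"
        using that sum_diff_nat_ivl[of 0 m n "\<lambda>k. a k *\<^sub>C g k"] by (simp add: lessThan_atLeast0)
      moreover have "(norm (\<Sum>k\<in>{m..<n}. a k *\<^sub>C g k))\<^sup>2 < e\<^sup>2"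
        using norm_orthogonal_sum_le[OF g, of "{m..<n}" a] N[OF that(1), of n] by simp
      ultimately show ?thesis using e by (simp add: power_less_imp_less_base)
    qed
    show "\<exists>M. \<forall>m\<ge>M. \<forall>n\<ge>M. norm ((\<Sum>k<m. a k *\<^sub>C g k) - (\<Sum>k<n. a k *\<^sub>C g k)) < e"
      by (rule exI[of _ N]) (metis le nat_le_linear norm_minus_commute)
  qed
  then show s: "summable (\<lambda>k. a k *\<^sub>C g k)"
    by (simp add: summable_iff_convergent Cauchy_convergent_iff)
  have "(\<lambda>n. (norm (\<Sum>k<n. a k *\<^sub>C g k))\<^sup>2) \<longlonglongrightarrow> (norm (\<Sum>k. a k *\<^sub>C g k))\<^sup>2"
    by (intro tendsto_power tendsto_norm summable_LIMSEQ s)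
  then show "(norm (\<Sum>k. a k *\<^sub>C g k))\<^sup>2 \<le> (\<Sum>k. (cmod (a k))\<^sup>2)"
  proof (rule LIMSEQ_le_const2, intro exI allI impI)
    fix n :: nat
    have "(norm (\<Sum>k<n. a k *\<^sub>C g k))\<^sup>2 \<le> (\<Sum>k<n. (cmod (a k))\<^sup>2)"
      by (rule norm_orthogonal_sum_le[OF g]) simp
    also have "\<dots> \<le> (\<Sum>k. (cmod (a k))\<^sup>2)" by (rule sum_le_suminf[OF a]) auto
    finally show "(norm (\<Sum>k<n. a k *\<^sub>C g k))\<^sup>2 \<le> (\<Sum>k. (cmod (a k))\<^sup>2)" .
  qed
qed

lemma bounded_clinear_suminf:
  fixes h :: "nat \<Rightarrow> 'a::complex_hilbert_space"
  assumes f: "\<And>k. bounded_clinear (f k)" and s: "\<And>x. summable (\<lambda>k. f k x)"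
    and b: "\<And>x. norm (\<Sum>k. f k x :: 'a) \<le> norm (x :: 'a) * K"
  shows "bounded_clinear (\<lambda>x. \<Sum>k. f k x)"
  unfolding bounded_clinear_def
proof (intro conjI allI)
  have lin: "bounded_linear (f k)" for k using f by (rule bounded_clinear_bounded_linear)
  show "bounded_linear (\<lambda>x. \<Sum>k. f k x)"
    by (rule bounded_linear_intro[OF _ _ b])
       (simp_all add: linear_simps[OF lin] suminf_add[OF s s] suminf_scaleR_right[OF s])
  show "(\<Sum>k. f k (c *\<^sub>C x)) = c *\<^sub>C (\<Sum>k. f k x)" for c x
    by (simp add: bounded_clinear_scaleC[OF f] bounded_linear.suminf[OF scaleC_bounded_linear s])
qed

lemma rank_one_bounded_clinear: "bounded_clinear (\<lambda>x. cinner x a *\<^sub>C b)"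
proof -
  have "bounded_linear (\<lambda>x. cinner x a *\<^sub>C b)"
    by (rule bounded_linear_intro[where K = "norm a * norm b"])
      (simp_all add: cinner_linear scaleC_add_left scaleR_scaleC scaleC_scaleC norm_scaleC
        mult.assoc[symmetric] norm_cinner_le mult_right_mono)
  then show ?thesis by (simp add: bounded_clinear_def cinner_linear scaleC_scaleC)
qed

text \<open>Bessel for \<open>g\<close> makes the coefficients square-summable, and Riesz-Fischer
  for \<open>h\<close> sums the series without increasing the norm. With \<open>g = h\<close>
  orthonormal this is the projection onto the closed span.\<close>

lemma diagonal_operator:
  fixes g h :: "nat \<Rightarrow> 'a::complex_hilbert_space"
  assumes g: "subnormal_seq g" and h: "subnormal_seq h"
  shows "summable (\<lambda>k. cinner x (g k) *\<^sub>C h k)"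
    and "norm (\<Sum>k. cinner x (g k) *\<^sub>C h k) \<le> norm x"
    and "bounded_clinear (\<lambda>x. \<Sum>k. cinner x (g k) *\<^sub>C h k)"
proof -
  note rf = riesz_fischer[OF h bessel_summable[OF g]]
  show s: "summable (\<lambda>k. cinner x (g k) *\<^sub>C h k)" for x by (rule rf)
  have le: "norm (\<Sum>k. cinner x (g k) *\<^sub>C h k) \<le> norm x" for x
  proof -
    have "(\<Sum>k. (cmod (cinner x (g k)))\<^sup>2) \<le> (norm x)\<^sup>2"
      by (rule suminf_le_const[OF bessel_summable[OF g]]) (simp add: bessel_finite[OF g])
    then have "(norm (\<Sum>k. cinner x (g k) *\<^sub>C h k))\<^sup>2 \<le> (norm x)\<^sup>2"
      using rf(2)[of x] by linarith
    then show ?thesis by simp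
  qed
  then show "norm (\<Sum>k. cinner x (g k) *\<^sub>C h k) \<le> norm x" .
  show "bounded_clinear (\<lambda>x. \<Sum>k. cinner x (g k) *\<^sub>C h k)"
    by (rule bounded_clinear_suminf[where K = 1])
      (use le s in \<open>auto intro: rank_one_bounded_clinear\<close>)
qed

subsection \<open>Orthonormal sets and bases\<close>

definition orthonormal_set :: "'a::complex_inner set \<Rightarrow> bool" where
  "orthonormal_set X \<longleftrightarrow> (\<forall>e\<in>X. \<forall>f\<in>X. cinner e f = (if e = f then 1 else 0))"

lemma orthonormal_setD:
  "orthonormal_set X \<Longrightarrow> e \<in> X \<Longrightarrow> f \<in> X \<Longrightarrow> cinner e f = (if e = f then 1 else 0)"
  by (simp add: orthonormal_set_def)

lemma orthonormal_set_norm: "orthonormal_set X \<Longrightarrow> x \<in> X \<Longrightarrow> norm x = 1"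
  by (simp add: orthonormal_set_def flip: cinner_self_eq_1)

lemma orthonormal_set_subset: "orthonormal_set X \<Longrightarrow> Y \<subseteq> X \<Longrightarrow> orthonormal_set Y"
  by (auto simp: orthonormal_set_def subset_iff)

lemma orthonormal_set_insert:
  assumes "orthonormal_set X" "norm x = 1" "\<And>y. y \<in> X \<Longrightarrow> cinner x y = 0"
  shows "orthonormal_set (insert x X)"
proof -
  have "cinner x x = 1" using assms(2) by (simp add: cinner_self_eq_1)
  moreover have "x \<notin> X" using assms(3)[of x] calculation by auto
  moreover have "cinner y x = 0" if "y \<in> X" for y using assms(3)[OF that] cinner_eq_0_commute by blast
  ultimately show ?thesis using assms(1,3) unfolding orthonormal_set_def by auto
qed

lemma orthonormal_seq_range: "orthonormal_seq g \<Longrightarrow> orthonormal_set (range g)"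
  using orthonormal_seq_inj[of g] by (auto simp: orthonormal_set_def orthonormal_seq_def inj_eq)

text \<open>Zorn's lemma gives a maximal orthonormal superset; a nonzero vector orthogonal to it
  could be normalised and added.\<close>

lemma orthonormal_set_extend:
  assumes "orthonormal_set E"
  shows "\<exists>B. E \<subseteq> B \<and> orthonormal_set B \<and> (\<forall>x. (\<forall>b\<in>B. cinner x b = 0) \<longrightarrow> x = 0)"
proof -
  define A where "A = {B. E \<subseteq> B \<and> orthonormal_set B}"
  have "A \<noteq> {}" using assms by (auto simp: A_def)
  moreover have "\<Union>C \<in> A" if C: "C \<noteq> {}" "subset.chain A C" for C
  proof -
    have "orthonormal_set (\<Union>C)"
      unfolding orthonormal_set_def
    proof (intro ballI)
      fix e f assume "e \<in> \<Union>C" "f \<in> \<Union>C"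
      then obtain X Y where XY: "X \<in> C" "Y \<in> C" "e \<in> X" "f \<in> Y" by blast
      with C(2) have "X \<subseteq> Y \<or> Y \<subseteq> X" by (auto simp: subset_chain_def)
      then obtain Z where "Z \<in> C" "e \<in> Z" "f \<in> Z" using XY by blast
      moreover have "orthonormal_set Z" using C(2) \<open>Z \<in> C\<close> by (auto simp: subset_chain_def A_def)
      ultimately show "cinner e f = (if e = f then 1 else 0)" by (simp add: orthonormal_set_def)
    qed
    moreover obtain X where "X \<in> C" using C(1) by blast
    moreover have "E \<subseteq> X" using C(2) \<open>X \<in> C\<close> by (auto simp: subset_chain_def A_def)
    ultimately show ?thesis by (auto simp: A_def)
  qed
  ultimately obtain B where B: "B \<in> A" "\<And>X. X \<in> A \<Longrightarrow> B \<subseteq> X \<Longrightarrow> X = B"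
    using subset_Zorn_nonempty[of A] by blast
  have "x = 0" if x: "\<And>b. b \<in> B \<Longrightarrow> cinner x b = 0" for x
  proof (rule ccontr)
    assume "x \<noteq> 0"
    define y where "y = complex_of_real (1 / norm x) *\<^sub>C x"
    have y: "norm y = 1" using \<open>x \<noteq> 0\<close> by (simp add: y_def norm_scaleC norm_divide)
    have "cinner y b = 0" if "b \<in> B" for b using x that by (simp add: y_def cinner_scaleC_left)
    then have "insert y B \<in> A"
      using B(1) orthonormal_set_insert[of B y] y by (auto simp: A_def)
    then have "y \<in> B" using B(2) by blast
    then have "cinner y y = 0" using x by (simp add: y_def cinner_scaleC_left)
    then show False using y by simp
  qed
  with B(1) show ?thesis unfolding A_def by blast
qed

lemma orthonormal_set_dist:
  assumes "orthonormal_set X" "x \<in> X" "y \<in> X" "x \<noteq> y"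
  shows "dist x y > 1"
proof -
  have "complex_of_real ((norm (x - y))\<^sup>2) = 2"
    using assms by (simp add: cinner_self_eq_norm[symmetric] cinner_linear orthonormal_set_def
        del: of_real_power)
  then have "(norm (x - y))\<^sup>2 = 2" by (metis of_real_eq_iff of_real_numeral)
  then have "1\<^sup>2 < (norm (x - y))\<^sup>2" by simp
  then show ?thesis unfolding dist_norm by (rule power_less_imp_less_base) simp
qed

text \<open>Orthonormal vectors are more than 1 apart, so points of a countable dense set chosen
  within 1/2 of them are distinct.\<close>

lemma orthonormal_set_countable:
  assumes "separable_space (euclidean :: 'a::complex_inner topology)" "orthonormal_set (X :: 'a set)"
  shows "countable X"
proof -
  obtain D :: "'a set" where D: "countable D" "closure D = UNIV"
    using assms(1) by (auto simp: separable_space_def)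
  have "\<exists>d\<in>D. dist d x < 1/2" for x
    using D(2) closure_approachable[of x D] by (metis UNIV_I half_gt_zero zero_less_one)
  then obtain d where d: "\<And>x. d x \<in> D" "\<And>x. dist (d x) x < 1/2" by metis
  have "inj_on d X"
  proof (rule inj_onI, rule ccontr)
    fix x y assume xy: "x \<in> X" "y \<in> X" "d x = d y" "x \<noteq> y"
    have "dist x y \<le> dist (d x) x + dist (d y) y"
      using dist_triangle[of x y "d x"] xy(3) by (simp add: dist_commute)
    then show False using d(2)[of x] d(2)[of y] orthonormal_set_dist[OF assms(2) xy(1,2,4)] by simp
  qed
  then show ?thesis
    by (rule countable_image_inj_on[rotated]) (use d(1) in \<open>auto intro: countable_subset[OF _ D(1)]\<close>)
qed

section \<open>Expansions along countable bases\<close>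

definition total_seq :: "(nat \<Rightarrow> 'a::complex_inner) \<Rightarrow> bool" where
  "total_seq w \<longleftrightarrow> subnormal_seq w \<and> (\<forall>x. (\<lambda>n. cinner x (w n) *\<^sub>C w n) sums x)"

text \<open>The enumeration is padded with zeros, so that finite sets need no separate treatment.\<close>

lemma total_seq_exists:
  fixes B :: "'a::complex_hilbert_space set"
  assumes B: "orthonormal_set B" and "countable B"
    and tot: "\<forall>x. (\<forall>b\<in>B. cinner x b = 0) \<longrightarrow> x = 0"
  shows "\<exists>w. total_seq w \<and> range w \<subseteq> insert 0 B"
proof -
  obtain i :: "'a \<Rightarrow> nat" where i: "inj_on i B" using \<open>countable B\<close> by (auto elim: countableE)
  define w where "w n = (if n \<in> i ` B then the_inv_into B i n else 0)" for n
  have w: "w n \<in> B \<and> i (w n) = n \<or> w n = 0" for n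
    using i by (auto simp: w_def the_inv_into_f_f)
  have wi: "w (i b) = b" if "b \<in> B" for b
    using i that by (simp add: w_def the_inv_into_f_f)
  have ww: "cinner (w m) (w n) = (if m = n \<and> w n \<noteq> 0 then 1 else 0)" for m n
    using w[of m] w[of n] B unfolding orthonormal_set_def by auto
  have nw: "norm (w n) \<le> 1" for n
    using w[of n] orthonormal_set_norm[OF B] by auto
  have sub: "subnormal_seq w" using ww nw by (simp add: subnormal_seq_def)
  have "(\<lambda>n. cinner x (w n) *\<^sub>C w n) sums x" for x
  proof -
    define y where "y = (\<Sum>n. cinner x (w n) *\<^sub>C w n)"
    have y: "(\<lambda>n. cinner x (w n) *\<^sub>C w n) sums y"
      using diagonal_operator(1)[OF sub sub] by (simp add: y_def summable_sums)
    \<comment> \<open>The series converges by Bessel alone; equal coefficients make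
      \<open>x - y\<close> orthogonal to \<open>B\<close>, hence zero.\<close>
    have "cinner y b = cinner x b" if b: "b \<in> B" for b
    proof -
      have "(\<lambda>n. cinner (cinner x (w n) *\<^sub>C w n) b) sums cinner y b"
        by (rule bounded_linear.sums[OF cinner_bounded_linear_left y])
      moreover have "cinner (cinner x (w n) *\<^sub>C w n) b = (if n = i b then cinner x b else 0)" for n
        using ww[of n "i b"] wi[OF b] orthonormal_set_norm[OF B b]
        by (auto simp: cinner_scaleC_left)
      ultimately have "(\<lambda>n. if n = i b then cinner x b else 0) sums cinner y b" by simp
      then show ?thesis using sums_unique2[OF _ sums_single[of "i b" "\<lambda>_. cinner x b"]] by simp
    qed
    then have "x - y = 0" using tot[rule_format, of "x - y"] by (simp add: cinner_diff_left)
    then show ?thesis using y by simp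
  qed
  then show ?thesis using sub w by (intro exI[of _ w]) (auto simp: total_seq_def)
qed

text \<open>The partial sums of the expansion of \<open>x\<close> lie in the span, which turns
  completeness in the sense of orthogonality into density.\<close>

lemma total_orthonormal_basis:
  fixes B :: "'a::complex_hilbert_space set"
  assumes "orthonormal_set B" "countable B" "\<forall>x. (\<forall>b\<in>B. cinner x b = 0) \<longrightarrow> x = 0"
  shows "orthonormal_basis B"
proof -
  obtain w where w: "total_seq w" "range w \<subseteq> insert 0 B"
    using total_seq_exists[OF assms] by blast
  have "x \<in> closure (cspan B)" for x
  proof -
    have "(\<lambda>n. \<Sum>k<n. cinner x (w k) *\<^sub>C w k) \<longlonglongrightarrow> x"
      using w(1) by (simp add: total_seq_def sums_def)
    moreover have "w k \<in> cspan B" for k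
      using w(2) complex_vector.span_base complex_vector.span_zero by (metis insertE range_subsetD)
    then have "(\<Sum>k<n. cinner x (w k) *\<^sub>C w k) \<in> cspan B" for n
      by (intro complex_vector.span_sum complex_vector.span_scale)
    ultimately show ?thesis
      unfolding closure_sequential by (intro exI[of _ "\<lambda>n. \<Sum>k<n. cinner x (w k) *\<^sub>C w k"]) simp
  qed
  then show ?thesis using assms(1) by (auto simp: orthonormal_basis_def orthonormal_set_def)
qed

lemma orthonormal_basis_extend:
  fixes E :: "'a::complex_hilbert_space set"
  assumes "separable_space (euclidean :: 'a topology)" "orthonormal_set E"
  shows "\<exists>B. E \<subseteq> B \<and> orthonormal_basis B \<and> countable B"
proof -
  obtain B where B: "E \<subseteq> B" "orthonormal_set B" "\<forall>x. (\<forall>b\<in>B. cinner x b = 0) \<longrightarrow> x = 0"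
    using orthonormal_set_extend[OF assms(2)] by blast
  have "countable B" by (rule orthonormal_set_countable[OF assms(1) B(2)])
  then show ?thesis using total_orthonormal_basis[of B] B by blast
qed

lemma orthonormal_basis_set: "orthonormal_basis B \<Longrightarrow> orthonormal_set B"
  by (simp add: orthonormal_basis_def orthonormal_set_def)

lemma separable_total_seq:
  assumes "separable_space (euclidean :: 'a::complex_hilbert_space topology)"
  obtains w :: "nat \<Rightarrow> 'a::complex_hilbert_space" where "total_seq w"
proof -
  have "orthonormal_set ({} :: 'a set)" by (simp add: orthonormal_set_def)
  from orthonormal_set_extend[OF this] obtain B :: "'a set" where B: "orthonormal_set B"
    "\<forall>x. (\<forall>b\<in>B. cinner x b = 0) \<longrightarrow> x = 0" by blast
  obtain w :: "nat \<Rightarrow> 'a" where "total_seq w"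
    using total_seq_exists[OF B(1) orthonormal_set_countable[OF assms B(1)] B(2)] by blast
  then show ?thesis by (rule that)
qed

text \<open>One Gram-Schmidt step, applied to a vector outside the span of the finite set.\<close>

lemma exists_unit_orthogonal:
  fixes X :: "'a::complex_inner set"
  assumes infinite_dim: "\<nexists>B :: 'a set. finite B \<and> cspan B = UNIV"
    and X: "orthonormal_set X" "finite X"
  shows "\<exists>x. norm x = 1 \<and> (\<forall>e\<in>X. cinner x e = 0)"
proof -
  obtain z where z: "z \<notin> cspan X" using infinite_dim X(2) by blast
  define y where "y = z - (\<Sum>e\<in>X. cinner z e *\<^sub>C e)"
  have "(\<Sum>e\<in>X. cinner z e *\<^sub>C e) \<in> cspan X"
    by (intro complex_vector.span_sum complex_vector.span_scale complex_vector.span_base)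
  then have "y \<noteq> 0" using z by (auto simp: y_def)
  have "cinner y e = 0" if e: "e \<in> X" for e
  proof -
    have "(\<Sum>f\<in>X. cinner z f * cinner f e) = (\<Sum>f\<in>X. if f = e then cinner z e else 0)"
      using X(1) e by (intro sum.cong) (auto simp: orthonormal_set_def)
    then show ?thesis using X(2) e by (simp add: y_def cinner_linear cinner_sum_left)
  qed
  then show ?thesis
    using \<open>y \<noteq> 0\<close> by (intro exI[of _ "complex_of_real (1 / norm y) *\<^sub>C y"])
      (simp add: norm_scaleC norm_divide cinner_scaleC_left)
qed

subsection \<open>Adjoints and compactness\<close>

text \<open>As a relation, adjointness can be used before the definite description
  \<open>cadjoint\<close> is known to denote anything.\<close>

definition is_adjoint :: "('a::complex_inner \<Rightarrow> 'a) \<Rightarrow> ('a \<Rightarrow> 'a) \<Rightarrow> bool" where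
  "is_adjoint T T' \<longleftrightarrow> (\<forall>x y. cinner (T x) y = cinner x (T' y))"

lemma is_adjointD: "is_adjoint T T' \<Longrightarrow> cinner (T x) y = cinner x (T' y)"
  by (simp add: is_adjoint_def)

lemma is_adjointD2: "is_adjoint T T' \<Longrightarrow> cinner (T' x) y = cinner x (T y)"
  by (metis cinner_commute is_adjoint_def)

lemma cadjoint_eq:
  assumes "is_adjoint T T'" shows "cadjoint T = T'"
proof -
  have "S = T'" if "\<forall>x y. cinner (T x) y = cinner x (S y)" for S
  proof (rule ext, rule cinner_eqI)
    fix y z show "cinner (S y) z = cinner (T' y) z"
      using that assms by (metis cinner_commute is_adjoint_def)
  qed
  then show ?thesis unfolding cadjoint_def
    using assms unfolding is_adjoint_def by (intro the_equality) blast+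
qed

text \<open>Along a basis \<open>b\<close> the coefficients of \<open>T' y\<close> must be
  \<open>cinner y (T (b n))\<close>; the point is that they are square-summable.\<close>

lemma adjoint_exists:
  fixes T :: "'a::complex_hilbert_space \<Rightarrow> 'a"
  assumes sep: "separable_space (euclidean :: 'a topology)" and T: "bounded_clinear T"
  obtains T' where "bounded_clinear T'" "is_adjoint T T'"
proof -
  obtain b :: "nat \<Rightarrow> 'a" where "total_seq b" by (rule separable_total_seq[OF sep])
  then have b: "subnormal_seq b" and exp: "(\<lambda>n. cinner x (b n) *\<^sub>C b n) sums x" for x
    by (auto simp: total_seq_def)
  note lin = bounded_clinear_bounded_linear[OF T]
  obtain K where K: "K \<ge> 0" "\<And>x. norm (T x) \<le> norm x * K"
    using bounded_linear.nonneg_bounded[OF lin] by blast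
  \<comment> \<open>Let \<open>z\<close> carry the first \<open>N\<close> coefficients. Then
    \<open>T z\<close> pairs with \<open>y\<close> to their square sum \<open>c\<close>, while
    \<open>z\<close> has norm at most \<open>sqrt c\<close>.\<close>
  have fin: "(\<Sum>n<N. (cmod (cinner y (T (b n))))\<^sup>2) \<le> (norm y * K)\<^sup>2" for y N
  proof -
    define a where "a n = cinner y (T (b n))" for n
    define c where "c = (\<Sum>n<N. (cmod (a n))\<^sup>2)"
    define z where "z = (\<Sum>n<N. a n *\<^sub>C b n)"
    have c0: "c \<ge> 0" by (simp add: c_def sum_nonneg)
    have "(norm z)\<^sup>2 \<le> c" unfolding z_def c_def by (rule norm_orthogonal_sum_le[OF b]) simp
    then have nz: "norm z \<le> sqrt c" by (rule real_le_rsqrt)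
    have "T z = (\<Sum>n<N. a n *\<^sub>C T (b n))"
      unfolding z_def linear_sum[OF bounded_linear.linear[OF lin]]
      by (simp add: bounded_clinear_scaleC[OF T])
    then have "cinner y (T z) = complex_of_real c"
      by (simp add: c_def cinner_sum_right cinner_scaleC_right complex_norm_square mult.commute
          a_def[symmetric] del: of_real_power)
    then have "c \<le> norm y * norm (T z)" using norm_cinner_le[of y "T z"] c0 by simp
    also have "\<dots> \<le> norm y * (sqrt c * K)"
      using K(2)[of z] nz K(1) by (intro mult_left_mono) (auto intro: order_trans mult_right_mono)
    finally have "c \<le> norm y * K * sqrt c" by (simp add: ac_simps)
    then show ?thesis using le_of_sq_le_mult_sqrt c0 unfolding c_def a_def by blast
  qed
  have sm: "summable (\<lambda>n. (cmod (cinner y (T (b n))))\<^sup>2)" for y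
    by (rule bounded_imp_summable[where B = "(norm y * K)\<^sup>2"])
      (use fin[of y "Suc _"] in \<open>simp_all add: lessThan_Suc_atMost\<close>)
  define T' where "T' y = (\<Sum>n. cinner y (T (b n)) *\<^sub>C b n)" for y
  have sv: "summable (\<lambda>n. cinner y (T (b n)) *\<^sub>C b n)" for y by (rule riesz_fischer[OF b sm])
  have "norm (T' y) \<le> norm y * K" for y
  proof -
    have "(norm (T' y))\<^sup>2 \<le> (\<Sum>n. (cmod (cinner y (T (b n))))\<^sup>2)"
      unfolding T'_def by (rule riesz_fischer[OF b sm])
    also have "\<dots> \<le> (norm y * K)\<^sup>2" by (rule suminf_le_const[OF sm fin])
    finally show ?thesis by (rule power2_le_imp_le) (simp add: K(1))
  qed
  then have "bounded_clinear T'"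
    using bounded_clinear_suminf[where f = "\<lambda>n y. cinner y (T (b n)) *\<^sub>C b n" and K = K,
        OF rank_one_bounded_clinear sv]
    by (simp add: T'_def[abs_def])
  moreover have "cinner (T x) y = cinner x (T' y)" for x y
  proof -
    have "(\<lambda>n. cinner x (cinner y (T (b n)) *\<^sub>C b n)) sums cinner x (T' y)"
      unfolding T'_def by (intro bounded_linear.sums[OF cinner_bounded_linear_right] summable_sums sv)
    moreover have "(\<lambda>n. cinner (T (cinner x (b n) *\<^sub>C b n)) y) sums cinner (T x) y"
      by (intro bounded_linear.sums[OF cinner_bounded_linear_left] bounded_linear.sums[OF lin] exp)
    moreover have "cinner (T (cinner x (b n) *\<^sub>C b n)) y = cinner x (cinner y (T (b n)) *\<^sub>C b n)" for n
      by (simp add: bounded_clinear_scaleC[OF T] cinner_linear cinner_commute[of "T (b n)"])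
    ultimately show ?thesis using sums_unique2 by simp
  qed
  ultimately show ?thesis using that by (simp add: is_adjoint_def)
qed

text \<open>Compactness by subsequences of arbitrary bounded sequences; in this form sums,
  compositions and adjoints need no rescaling to the unit ball.\<close>

definition seq_compact_map :: "('a::complex_inner \<Rightarrow> 'a) \<Rightarrow> bool" where
  "seq_compact_map T \<longleftrightarrow> bounded_clinear T \<and>
    (\<forall>x :: nat \<Rightarrow> 'a. bounded (range x) \<longrightarrow> (\<exists>r. strict_mono r \<and> convergent (\<lambda>n. T (x (r n)))))"

lemma seq_compact_mapD:
  assumes "seq_compact_map T" "\<And>n. norm (x n) \<le> K"
  obtains r l where "strict_mono (r :: nat \<Rightarrow> nat)" "(\<lambda>n. T (x (r n))) \<longlonglongrightarrow> l"
proof -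
  have "bounded (range x)" using assms(2) by (auto simp: bounded_iff)
  then obtain r where "strict_mono r" "convergent (\<lambda>n. T (x (r n)))"
    using assms(1) unfolding seq_compact_map_def by blast
  then show ?thesis using that unfolding convergent_def by blast
qed

lemma bounded_rangeE:
  assumes "bounded (range x)" obtains K where "K > 0" "\<And>n. norm (x n) \<le> K"
  using assms unfolding bounded_pos by blast

lemma compact_operator_seq_compact:
  assumes "compact_operator T" shows "seq_compact_map T"
proof -
  have T: "bounded_clinear T" and c: "seq_compact (closure (T ` cball 0 1))"
    using assms by (auto simp: compact_operator_def compact_eq_seq_compact_metric)
  note lin = bounded_clinear_bounded_linear[OF T]
  have "\<exists>r. strict_mono r \<and> convergent (\<lambda>n. T (x (r n)))" if x: "bounded (range x)" for x :: "nat \<Rightarrow> 'a"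
  proof -
    obtain K where K: "K > 0" "\<And>n. norm (x n) \<le> K" by (rule bounded_rangeE[OF x], rule that)
    define y where "y n = (1 / K) *\<^sub>R x n" for n
    have "norm (y n) \<le> 1" for n using K by (simp add: y_def)
    then have "\<forall>n. T (y n) \<in> closure (T ` cball 0 1)"
      by (intro allI subsetD[OF closure_subset] imageI) simp
    then obtain l r where r: "strict_mono r" "((\<lambda>n. T (y n)) \<circ> r) \<longlonglongrightarrow> l"
      using c unfolding seq_compact_def by meson
    then have "(\<lambda>n. K *\<^sub>R T (y (r n))) \<longlonglongrightarrow> K *\<^sub>R l" by (intro tendsto_intros) (simp add: o_def)
    moreover have "K *\<^sub>R T (y n) = T (x n)" for n
      using K(1) by (simp add: y_def linear_simps[OF lin])
    ultimately show ?thesis using r(1) unfolding convergent_def by auto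
  qed
  with T show ?thesis by (simp add: seq_compact_map_def)
qed

lemma seq_compact_map_bounded_clinear: "seq_compact_map T \<Longrightarrow> bounded_clinear T"
  by (simp add: seq_compact_map_def)

lemma seq_compact_mapI:
  assumes "bounded_clinear T"
    and "\<And>x :: nat \<Rightarrow> 'a::complex_inner. bounded (range x) \<Longrightarrow>
      \<exists>r. strict_mono r \<and> convergent (\<lambda>n. T (x (r n)))"
  shows "seq_compact_map T"
  using assms by (simp add: seq_compact_map_def)

lemma seq_compact_map_bounded_range:
  fixes x :: "nat \<Rightarrow> 'a::complex_inner"
  assumes "seq_compact_map T" "bounded (range x)"
  shows "\<exists>r. strict_mono r \<and> convergent (\<lambda>n. T (x (r n)))"
  using assms by (simp add: seq_compact_map_def)

lemma seq_compact_map_compose: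
  assumes S: "bounded_clinear S" and T: "seq_compact_map T"
  shows "seq_compact_map (\<lambda>x. S (T x))"
proof (rule seq_compact_mapI)
  fix x :: "nat \<Rightarrow> 'a" assume "bounded (range x)"
  then obtain r where r: "strict_mono r" "convergent (\<lambda>n. T (x (r n)))"
    using seq_compact_map_bounded_range[OF T] by blast
  then have "convergent (\<lambda>n. S (T (x (r n))))"
    using bounded_linear.tendsto[OF bounded_clinear_bounded_linear[OF S]]
    unfolding convergent_def by blast
  with r(1) show "\<exists>r. strict_mono r \<and> convergent (\<lambda>n. S (T (x (r n))))" by blast
qed (rule bounded_clinear_compose[OF S seq_compact_map_bounded_clinear[OF T]])

lemma seq_compact_map_compose_right:
  assumes S: "seq_compact_map S" and T: "bounded_clinear T"
  shows "seq_compact_map (\<lambda>x. S (T x))"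
proof (rule seq_compact_mapI)
  fix x :: "nat \<Rightarrow> 'a" assume "bounded (range x)"
  then have "bounded (range (\<lambda>n. T (x n)))"
    using bounded_linear_image[OF _ bounded_clinear_bounded_linear[OF T], of "range x"]
    by (simp add: image_image)
  then show "\<exists>r. strict_mono r \<and> convergent (\<lambda>n. S (T (x (r n))))"
    by (rule seq_compact_map_bounded_range[OF S])
qed (rule bounded_clinear_compose[OF seq_compact_map_bounded_clinear[OF S] T])

lemma seq_compact_map_add:
  assumes S: "seq_compact_map S" and T: "seq_compact_map T"
  shows "seq_compact_map (\<lambda>x. S x + T x)"
proof (rule seq_compact_mapI)
  fix x :: "nat \<Rightarrow> 'a" assume x: "bounded (range x)"
  obtain r where r: "strict_mono r" "convergent (\<lambda>n. S (x (r n)))"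
    using seq_compact_map_bounded_range[OF S x] by blast
  have "bounded (range (\<lambda>n. x (r n)))" by (rule bounded_subset[OF x]) auto
  then obtain q where q: "strict_mono q" "convergent (\<lambda>n. T (x (r (q n))))"
    using seq_compact_map_bounded_range[OF T] by blast
  have "convergent (\<lambda>n. S (x (r (q n))))"
    using convergent_subseq_convergent[OF r(2) q(1)] by (simp add: o_def)
  then have "convergent (\<lambda>n. S (x ((r \<circ> q) n)) + T (x ((r \<circ> q) n)))"
    using q(2) by (simp add: convergent_add)
  then show "\<exists>r. strict_mono r \<and> convergent (\<lambda>n. S (x (r n)) + T (x (r n)))"
    using strict_mono_o[OF r(1) q(1)] by blast
qed (intro bounded_clinear_add seq_compact_map_bounded_clinear S T)

text \<open>Schauder's theorem, from \<open>\<parallel>T\<^sup>* z\<parallel>\<^sup>2 = \<langle>T T\<^sup>* z, z\<rangle>\<close>.\<close>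

lemma seq_compact_map_adjoint:
  fixes T :: "'a::complex_hilbert_space \<Rightarrow> 'a"
  assumes T: "seq_compact_map T" and T': "bounded_clinear T'" and adj: "is_adjoint T T'"
  shows "seq_compact_map T'"
proof -
  note lin = bounded_clinear_bounded_linear[OF T']
  have linT: "bounded_linear T" using T by (simp add: seq_compact_map_def bounded_clinear_def)
  have "\<exists>r. strict_mono r \<and> convergent (\<lambda>n. T' (x (r n)))" if x: "bounded (range x)" for x :: "nat \<Rightarrow> 'a"
  proof -
    obtain K where K: "K > 0" "\<And>n. norm (x n) \<le> K" by (rule bounded_rangeE[OF x], rule that)
    obtain r where r: "strict_mono r" "convergent (\<lambda>n. T (T' (x (r n))))"
      using seq_compact_map_bounded_range[OF seq_compact_map_compose_right[OF T T'] x] by blast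
    define z where "z n = T (T' (x (r n)))" for n
    have le: "(norm (T' (x (r m)) - T' (x (r n))))\<^sup>2 \<le> norm (z m - z n) * (2 * K)" for m n
    proof -
      let ?d = "x (r m) - x (r n)"
      have "(norm (T' ?d))\<^sup>2 = Re (cinner (T (T' ?d)) ?d)"
        by (simp add: is_adjointD[OF adj] Re_cinner_self)
      also have "\<dots> \<le> norm (T (T' ?d)) * norm ?d"
        by (rule order_trans[OF complex_Re_le_cmod norm_cinner_le])
      also have "\<dots> \<le> norm (T (T' ?d)) * (2 * K)"
        using norm_triangle_ineq4[of "x (r m)" "x (r n)"] K(2)[of "r m"] K(2)[of "r n"]
        by (intro mult_left_mono) auto
      finally show ?thesis by (simp add: linear_simps[OF lin] linear_simps[OF linT] z_def)
    qed
    have "Cauchy z" using convergent_Cauchy[OF r(2)] by (simp add: z_def[abs_def])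
    have "Cauchy (\<lambda>n. T' (x (r n)))"
    proof (rule CauchyI)
      fix e :: real assume e: "e > 0"
      then have "e\<^sup>2 / (2 * K) > 0" using K(1) by simp
      with \<open>Cauchy z\<close> obtain M where M: "\<forall>m\<ge>M. \<forall>n\<ge>M. norm (z m - z n) < e\<^sup>2 / (2 * K)"
        by (meson CauchyD)
      have "norm (T' (x (r m)) - T' (x (r n))) < e" if "m \<ge> M" "n \<ge> M" for m n
      proof (rule power_less_imp_less_base)
        have "norm (z m - z n) * (2 * K) < e\<^sup>2" using M that K(1) by (simp add: pos_less_divide_eq)
        then show "(norm (T' (x (r m)) - T' (x (r n))))\<^sup>2 < e\<^sup>2" using le[of m n] by linarith
      qed (use e in simp)
      then show "\<exists>M. \<forall>m\<ge>M. \<forall>n\<ge>M. norm (T' (x (r m)) - T' (x (r n))) < e" by blast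
    qed
    then show ?thesis using r(1) by (auto simp: Cauchy_convergent_iff)
  qed
  with T' show ?thesis by (simp add: seq_compact_map_def)
qed

text \<open>Otherwise some subsequence of images stays away from 0 and, by compactness, converges to
  some \<open>l\<close>. Moving \<open>T\<close> to the adjoint and applying Bessel shows that the
  images tend weakly to 0, so \<open>l = 0\<close>.\<close>

lemma seq_compact_map_orthonormal_tendsto_0:
  fixes T :: "'a::complex_hilbert_space \<Rightarrow> 'a"
  assumes T: "seq_compact_map T" and adj: "is_adjoint T T'" and g: "orthonormal_seq g"
  shows "(\<lambda>n. T (g n)) \<longlonglongrightarrow> 0"
proof (rule ccontr)
  assume "\<not> (\<lambda>n. T (g n)) \<longlonglongrightarrow> 0"
  then obtain e where e: "e > 0" "\<exists>\<^sub>F n in sequentially. norm (T (g n)) \<ge> e"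
    unfolding tendsto_iff by (auto simp: not_eventually not_less)
  then have "infinite {n. norm (T (g n)) \<ge> e}" by (simp add: frequently_cofinite flip: cofinite_eq_sequentially)
  then obtain q :: "nat \<Rightarrow> nat" where q: "strict_mono q" "\<And>n. norm (T (g (q n))) \<ge> e"
    using infinite_enumerate by blast
  obtain r l where r: "strict_mono r" "(\<lambda>n. T (g (q (r n)))) \<longlonglongrightarrow> l"
    using seq_compact_mapD[OF T, of "\<lambda>n. g (q n)" 1] orthonormal_seq_norm[OF g] by auto
  have inj: "inj (q \<circ> r)" by (intro strict_mono_imp_inj_on strict_mono_o q(1) r(1))
  have "cinner l y = 0" for y
  proof -
    have "(\<lambda>n. cinner (T (g (q (r n)))) y) \<longlonglongrightarrow> cinner l y" by (intro tendsto_cinner r tendsto_const)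
    moreover have "(\<lambda>n. cinner (T' y) (g (q (r n)))) \<longlonglongrightarrow> 0"
      using cinner_orthonormal_tendsto_0[OF orthonormal_imp_subnormal_seq[OF orthonormal_seq_comp[OF g inj]]]
      by (simp add: o_def)
    then have "(\<lambda>n. cnj (cinner (T' y) (g (q (r n))))) \<longlonglongrightarrow> cnj 0" by (intro tendsto_cnj)
    then have "(\<lambda>n. cinner (T (g (q (r n)))) y) \<longlonglongrightarrow> 0"
      by (simp add: is_adjointD[OF adj] flip: cinner_commute)
    ultimately show ?thesis by (rule LIMSEQ_unique)
  qed
  then have "l = 0" by (metis cinner_self_eq_0)
  then have "(\<lambda>n. norm (T (g (q (r n))))) \<longlonglongrightarrow> 0" using r(2) tendsto_norm_zero by blast
  then have "e \<le> 0" using q(2) by (intro LIMSEQ_le_const) auto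
  with e(1) show False by simp
qed

subsection \<open>Spectral theorem for compact self-adjoint operators\<close>

lemma norm_diff_square: "(norm (x - y))\<^sup>2 = (norm x)\<^sup>2 + (norm y)\<^sup>2 - 2 * inner x (y :: 'a::real_inner)"
  by (simp add: power2_norm_eq_inner inner_diff_left inner_diff_right inner_commute)

text \<open>On a closed invariant subspace \<open>V\<close>, a sequence of unit vectors maximising
  the norm of \<open>A x\<close> converges along a subsequence to an eigenvector of the square of
  \<open>A\<close> for \<open>M\<^sup>2\<close>; from it an eigenvector of \<open>A\<close> for
  \<open>M\<close> or \<open>- M\<close> is extracted.\<close>

lemma exists_extremal_eigenvector:
  fixes A :: "'a::complex_hilbert_space \<Rightarrow> 'a"
  assumes A: "seq_compact_map A" and sa: "is_adjoint A A"
    and V: "closed V" "\<And>x y. x \<in> V \<Longrightarrow> y \<in> V \<Longrightarrow> x + y \<in> V"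
      "\<And>c x. x \<in> V \<Longrightarrow> c *\<^sub>C x \<in> V" "\<And>x. x \<in> V \<Longrightarrow> A x \<in> V" "z \<in> V" "norm z = 1"
  shows "\<exists>g l. g \<in> V \<and> norm g = 1 \<and> A g = complex_of_real l *\<^sub>C g
    \<and> (\<forall>x\<in>V. norm (A x) \<le> \<bar>l\<bar> * norm x)"
proof -
  have bc: "bounded_clinear A" by (rule seq_compact_map_bounded_clinear[OF A])
  note lin = bounded_clinear_bounded_linear[OF bc]
  note cA = bounded_linear.tendsto[OF lin]
  have scV: "r *\<^sub>R x \<in> V" if "x \<in> V" for r x using V(3)[OF that] by (simp add: scaleR_scaleC)
  obtain K where K: "\<And>x. norm (A x) \<le> norm x * K" using bounded_linear.bounded[OF lin] by blast
  define U where "U = {x \<in> V. norm x = 1}"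
  define M where "M = (SUP x\<in>U. norm (A x))"
  have bdd: "bdd_above ((\<lambda>x. norm (A x)) ` U)"
    using K by (intro bdd_aboveI2[where M = K]) (metis (mono_tags, lifting) U_def mem_Collect_eq mult_1)
  have "z \<in> U" using V(5,6) by (simp add: U_def)
  have leM: "norm (A x) \<le> M * norm x" if x: "x \<in> V" for x
  proof (cases "x = 0")
    case False
    then have "(1 / norm x) *\<^sub>R x \<in> U" using scV[OF x] by (simp add: U_def)
    then have "norm (A ((1 / norm x) *\<^sub>R x)) \<le> M" unfolding M_def by (rule cSUP_upper[OF _ bdd])
    then show ?thesis using False by (simp add: linear_simps[OF lin] divide_simps)
  qed (simp add: linear_simps[OF lin])
  have M0: "M \<ge> 0" using leM[OF V(5)] V(6) order_trans[OF norm_ge_zero[of "A z"]] by simp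
  show ?thesis
  proof (cases "M = 0")
    case True
    \<comment> \<open>If the supremum is 0, \<open>A\<close> vanishes on \<open>V\<close> and any
      unit vector of \<open>V\<close> serves.\<close>
    then have "A z = 0" using leM[OF V(5)] by simp
    then show ?thesis using True leM V(5,6) by (intro exI[of _ z] exI[of _ 0]) auto
  next
    case False
    then have Mp: "M > 0" using M0 by simp
    have "\<exists>x\<in>U. M - 1 / Suc n < norm (A x)" for n
      unfolding M_def using \<open>z \<in> U\<close> by (subst less_cSUP_iff[symmetric, OF _ bdd]) auto
    then obtain x where x: "\<And>n. x n \<in> U" "\<And>n. M - 1 / Suc n < norm (A (x n))" by metis
    have xV: "x n \<in> V" "norm (x n) = 1" for n using x(1)[of n] by (auto simp: U_def)
    have "(\<lambda>n. M - 1 / Suc n) \<longlonglongrightarrow> M - 0"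
      by (intro tendsto_diff tendsto_const LIMSEQ_Suc[OF lim_1_over_n])
    then have lim0: "(\<lambda>n. M - 1 / Suc n) \<longlonglongrightarrow> M" by simp
    have lim: "(\<lambda>n. norm (A (x n))) \<longlonglongrightarrow> M"
    proof (rule tendsto_sandwich[OF _ _ lim0 tendsto_const])
      show "\<forall>\<^sub>F n in sequentially. M - 1 / Suc n \<le> norm (A (x n))"
        using x(2) by (intro always_eventually allI less_imp_le)
      show "\<forall>\<^sub>F n in sequentially. norm (A (x n)) \<le> M"
        using leM[OF xV(1)] by (simp add: xV(2))
    qed
    define d where "d n = A (A (x n)) - M\<^sup>2 *\<^sub>R x n" for n
    \<comment> \<open>Expanding the square, the cross term is \<open>- 2 * M\<^sup>2\<close> times
      the squared norm of \<open>A (x n)\<close>, and the bound \<open>M\<close> is used once more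
      on \<open>A (x n)\<close>.\<close>
    have dle: "(norm (d n))\<^sup>2 \<le> M\<^sup>2 * (M\<^sup>2 - (norm (A (x n)))\<^sup>2)" for n
    proof -
      have "inner (A (A (x n))) (x n) = (norm (A (x n)))\<^sup>2"
        by (simp add: inner_eq_Re_cinner is_adjointD[OF sa, of "A (x n)"] Re_cinner_self)
      moreover have "(norm (A (A (x n))))\<^sup>2 \<le> (M * norm (A (x n)))\<^sup>2"
        by (rule power_mono[OF leM[OF V(4)[OF xV(1)]]]) simp
      ultimately show ?thesis unfolding d_def norm_diff_square
        by (simp add: xV(2) power_mult_distrib algebra_simps power2_eq_square)
    qed
    have "(\<lambda>n. M\<^sup>2 * (M\<^sup>2 - (norm (A (x n)))\<^sup>2)) \<longlonglongrightarrow> M\<^sup>2 * (M\<^sup>2 - M\<^sup>2)"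
      by (intro tendsto_intros lim)
    then have lim1: "(\<lambda>n. M\<^sup>2 * (M\<^sup>2 - (norm (A (x n)))\<^sup>2)) \<longlonglongrightarrow> 0" by simp
    have "(\<lambda>n. (norm (d n))\<^sup>2) \<longlonglongrightarrow> 0"
      by (rule tendsto_sandwich[OF _ _ tendsto_const lim1]) (simp_all add: dle)
    then have "(\<lambda>n. sqrt ((norm (d n))\<^sup>2)) \<longlonglongrightarrow> sqrt 0" by (rule tendsto_real_sqrt)
    then have d0: "d \<longlonglongrightarrow> 0" by (simp add: tendsto_norm_zero_iff)
    obtain r y where r: "strict_mono r" and y: "(\<lambda>n. A (x (r n))) \<longlonglongrightarrow> y"
      using seq_compact_mapD[OF A, of x 1] xV(2) by auto
    have dr: "(\<lambda>n. d (r n)) \<longlonglongrightarrow> 0" using LIMSEQ_subseq_LIMSEQ[OF d0 r] by (simp add: o_def)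
    \<comment> \<open>Compactness speaks of \<open>A (x (r n))\<close> only. As
      \<open>A (A (x n)) - d n\<close> equals \<open>M\<^sup>2\<close> times \<open>x n\<close>, the
      vectors \<open>x (r n)\<close> themselves converge, to \<open>w\<close>.\<close>
    define w where "w = (1 / M\<^sup>2) *\<^sub>R A y"
    have "(\<lambda>n. (1 / M\<^sup>2) *\<^sub>R (A (A (x (r n))) - d (r n))) \<longlonglongrightarrow> (1 / M\<^sup>2) *\<^sub>R (A y - 0)"
      by (intro tendsto_intros cA y dr)
    then have xw: "(\<lambda>n. x (r n)) \<longlonglongrightarrow> w" using Mp by (simp add: d_def w_def)
    have wV: "w \<in> V" using closed_sequentially[OF V(1) _ xw] xV(1) by simp
    have nw: "norm w = 1" using LIMSEQ_unique[OF tendsto_norm[OF xw]] xV(2) by simp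
    have "(\<lambda>n. d (r n)) \<longlonglongrightarrow> A (A w) - M\<^sup>2 *\<^sub>R w" unfolding d_def by (intro tendsto_intros cA xw)
    then have "A (A w) - M\<^sup>2 *\<^sub>R w = 0" by (rule LIMSEQ_unique[OF _ dr])
    then have AAw: "A (A w) = M\<^sup>2 *\<^sub>R w" by simp
    \<comment> \<open>Since \<open>(A - M)(A + M)\<close> annihilates \<open>w\<close>, either
      \<open>p\<close> is an eigenvector for \<open>M\<close>, or \<open>p = 0\<close> and
      \<open>w\<close> is one for \<open>- M\<close>.\<close>
    define p where "p = A w + M *\<^sub>R w"
    show ?thesis
    proof (cases "p = 0")
      case True
      then have "A w = complex_of_real (- M) *\<^sub>C w"
        by (simp add: p_def add_eq_0_iff scaleC_minus_left flip: scaleR_scaleC)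
      then show ?thesis using wV nw leM Mp by (intro exI[of _ w] exI[of _ "- M"]) auto
    next
      case False
      have "A p = M *\<^sub>R p"
        by (simp add: p_def linear_simps[OF lin] AAw scaleR_add_right power2_eq_square)
      then have "A ((1 / norm p) *\<^sub>R p) = complex_of_real M *\<^sub>C ((1 / norm p) *\<^sub>R p)"
        by (simp add: linear_simps[OF lin] flip: scaleR_scaleC)
      moreover have "(1 / norm p) *\<^sub>R p \<in> V"
        unfolding p_def by (intro scV V(2) V(4) wV)
      ultimately show ?thesis using False leM Mp
        by (intro exI[of _ "(1 / norm p) *\<^sub>R p"] exI[of _ M]) auto
    qed
  qed
qed

text \<open>The last clause records extremality on the orthogonal complement of the first
  \<open>n\<close> eigenvectors. It orders the eigenvalues by modulus and controls remainders, so
  \<open>g\<close> may miss part of the kernel.\<close>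

definition spectral_seq :: "('a::complex_inner \<Rightarrow> 'a) \<Rightarrow> (nat \<Rightarrow> 'a) \<Rightarrow> (nat \<Rightarrow> real) \<Rightarrow> bool" where
  "spectral_seq A g l \<longleftrightarrow> orthonormal_seq g \<and> (\<forall>n. A (g n) = complex_of_real (l n) *\<^sub>C g n) \<and>
    (\<forall>n x. (\<forall>i<n. cinner x (g i) = 0) \<longrightarrow> norm (A x) \<le> \<bar>l n\<bar> * norm x)"

text \<open>Vector and eigenvalue are chosen together, extremal on the complement of the earlier
  vectors. That complement is invariant by self-adjointness and nonzero by infinite
  dimension.\<close>

lemma spectral_seq_exists:
  fixes A :: "'a::complex_hilbert_space \<Rightarrow> 'a"
  assumes A: "seq_compact_map A" and sa: "is_adjoint A A"
    and infinite_dim: "\<nexists>B :: 'a set. finite B \<and> cspan B = UNIV"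
  obtains g l where "spectral_seq A g l"
proof -
  define P where "P f n y \<longleftrightarrow> (\<forall>i<n. cinner (fst y) (fst (f i)) = 0) \<and> norm (fst y) = 1
      \<and> A (fst y) = complex_of_real (snd y) *\<^sub>C fst y
      \<and> (\<forall>x. (\<forall>i<n. cinner x (fst (f i)) = 0) \<longrightarrow> norm (A x) \<le> \<bar>snd y\<bar> * norm x)"
    for f :: "nat \<Rightarrow> 'a \<times> real" and n and y :: "'a \<times> real"
  have "\<exists>f. \<forall>n. P f n (f n)"
  proof (rule dependent_wf_choice[where R = less_than])
    show "wf less_than" by simp
    show "P f n y = P g n y" if "\<And>z. (z, n) \<in> less_than \<Longrightarrow> f z = g z" for f g n y
      using that by (simp add: P_def)
    fix n f assume Pf: "\<And>i. (i, n) \<in> less_than \<Longrightarrow> P f i (f i)"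
    define X where "X = (fst \<circ> f) ` {..<n}"
    define V where "V = {x. \<forall>i<n. cinner x (fst (f i)) = 0}"
    have f: "cinner (fst (f i)) (fst (f j)) = 0" if "i < n" "j < n" "i \<noteq> j" for i j
      using Pf[of i] Pf[of j] that cinner_eq_0_commute by (cases "i < j") (auto simp: P_def)
    have f1: "norm (fst (f i)) = 1" "A (fst (f i)) = complex_of_real (snd (f i)) *\<^sub>C fst (f i)"
      if "i < n" for i using Pf[of i] that by (auto simp: P_def)
    have "orthonormal_set X"
      unfolding orthonormal_set_def X_def using f f1(1) by (auto simp: cinner_self_eq_1)
    moreover have "finite X" by (simp add: X_def)
    ultimately obtain z where z: "norm z = 1" "\<forall>e\<in>X. cinner z e = 0"
      using exists_unit_orthogonal[OF infinite_dim] by blast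
    have "\<exists>g l. g \<in> V \<and> norm g = 1 \<and> A g = complex_of_real l *\<^sub>C g
      \<and> (\<forall>x\<in>V. norm (A x) \<le> \<bar>l\<bar> * norm x)"
    proof (rule exists_extremal_eigenvector[OF A sa, of V z])
      have "V = (\<Inter>i\<in>{..<n}. {x. cinner x (fst (f i)) = 0})" by (auto simp: V_def)
      then show "closed V"
        by (simp add: closed_INT closed_Collect_eq linear_continuous_on[OF cinner_bounded_linear_left])
      show "A x \<in> V" if "x \<in> V" for x
        using that by (simp add: V_def is_adjointD[OF sa] f1(2) cinner_scaleC_right)
    qed (use z in \<open>auto simp: V_def X_def cinner_linear\<close>)
    then obtain g l where "P f n (g, l)" unfolding P_def V_def by auto
    then show "\<exists>y. P f n y" by blast
  qed
  then obtain f where f: "\<And>n. P f n (f n)" by blast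
  have 0: "cinner (fst (f i)) (fst (f j)) = 0" if "i \<noteq> j" for i j
    using f[of i] f[of j] that cinner_eq_0_commute by (cases "i < j") (auto simp: P_def)
  have "orthonormal_seq (fst \<circ> f)"
    using f 0 by (simp add: orthonormal_seq_def P_def cinner_self_eq_1)
  then have "spectral_seq A (fst \<circ> f) (snd \<circ> f)"
    using f unfolding spectral_seq_def P_def o_def by blast
  then show ?thesis by (rule that)
qed

lemma spectral_seq_orthonormal: "spectral_seq A g l \<Longrightarrow> orthonormal_seq g"
  by (simp add: spectral_seq_def)

lemma spectral_seq_eigen: "spectral_seq A g l \<Longrightarrow> A (g n) = complex_of_real (l n) *\<^sub>C g n"
  by (simp add: spectral_seq_def)

lemma spectral_seq_bound:
  "spectral_seq A g l \<Longrightarrow> (\<And>i. i < n \<Longrightarrow> cinner x (g i) = 0) \<Longrightarrow> norm (A x) \<le> \<bar>l n\<bar> * norm x"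
  unfolding spectral_seq_def by blast

lemma spectral_seq_antimono:
  assumes s: "spectral_seq A g l" and "m \<le> n"
  shows "\<bar>l n\<bar> \<le> \<bar>l m\<bar>"
proof -
  have "norm (A (g n)) \<le> \<bar>l m\<bar> * norm (g n)"
    using spectral_seq_orthonormal[OF s] assms(2)
    by (intro spectral_seq_bound[OF s]) (simp add: orthonormal_seq_def)
  then show ?thesis
    by (simp add: spectral_seq_eigen[OF s] norm_scaleC orthonormal_seq_norm[OF spectral_seq_orthonormal[OF s]])
qed

text \<open>The remainder after \<open>n\<close> terms is \<open>A\<close> applied to a vector
  orthogonal to the first \<open>n\<close> eigenvectors, hence of norm at most a multiple of
  \<open>\<bar>l n\<bar>\<close>, which tends to 0 by compactness.\<close>

lemma spectral_seq_sums:
  fixes A :: "'a::complex_hilbert_space \<Rightarrow> 'a"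
  assumes A: "seq_compact_map A" and sa: "is_adjoint A A" and s: "spectral_seq A g l"
  shows "(\<lambda>n. (complex_of_real (l n) * cinner x (g n)) *\<^sub>C g n) sums A x"
proof -
  note on = spectral_seq_orthonormal[OF s]
  have bc: "bounded_clinear A" by (rule seq_compact_map_bounded_clinear[OF A])
  note lin = bounded_clinear_bounded_linear[OF bc]
  have "(\<lambda>n. norm (A (g n))) \<longlonglongrightarrow> 0"
    using seq_compact_map_orthonormal_tendsto_0[OF A sa on] by (rule tendsto_norm_zero)
  then have "(\<lambda>n. \<bar>l n\<bar>) \<longlonglongrightarrow> 0"
    by (simp add: spectral_seq_eigen[OF s] norm_scaleC orthonormal_seq_norm[OF on])
  then have lim: "(\<lambda>n. \<bar>l n\<bar> * (2 * norm x)) \<longlonglongrightarrow> 0" by (rule tendsto_mult_left_zero)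
  have "norm (A x - (\<Sum>k<n. (complex_of_real (l k) * cinner x (g k)) *\<^sub>C g k)) \<le> \<bar>l n\<bar> * (2 * norm x)" for n
  proof -
    define y where "y = (\<Sum>k<n. cinner x (g k) *\<^sub>C g k)"
    have Ay: "A y = (\<Sum>k<n. (complex_of_real (l k) * cinner x (g k)) *\<^sub>C g k)"
      unfolding y_def linear_sum[OF bounded_linear.linear[OF lin]]
      by (simp add: bounded_clinear_scaleC[OF bc] spectral_seq_eigen[OF s] scaleC_scaleC mult.commute)
    have "(norm y)\<^sup>2 \<le> (\<Sum>k<n. (cmod (cinner x (g k)))\<^sup>2)"
      unfolding y_def by (rule norm_orthogonal_sum_le[OF orthonormal_imp_subnormal_seq[OF on]]) simp
    also have "\<dots> \<le> (norm x)\<^sup>2"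
      by (rule bessel_finite[OF orthonormal_imp_subnormal_seq[OF on]]) simp
    finally have "norm y \<le> norm x" by simp
    then have nxy: "norm (x - y) \<le> 2 * norm x" using norm_triangle_ineq4[of x y] by simp
    have "cinner y (g i) = cinner x (g i)" if "i < n" for i
    proof -
      have "cinner y (g i) = (\<Sum>k<n. if k = i then cinner x (g i) else 0)"
        using on unfolding y_def cinner_sum_left
        by (intro sum.cong) (auto simp: orthonormal_seq_def cinner_scaleC_left)
      then show ?thesis using that by simp
    qed
    then have "norm (A (x - y)) \<le> \<bar>l n\<bar> * norm (x - y)"
      by (intro spectral_seq_bound[OF s]) (simp add: cinner_diff_left)
    also have "\<dots> \<le> \<bar>l n\<bar> * (2 * norm x)" using nxy by (simp add: mult_left_mono)
    finally show ?thesis by (simp add: linear_simps[OF lin] Ay)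
  qed
  then have "(\<lambda>n. A x - (\<Sum>k<n. (complex_of_real (l k) * cinner x (g k)) *\<^sub>C g k)) \<longlonglongrightarrow> 0"
    by (intro Lim_null_comparison[OF _ lim]) auto
  then have "(\<lambda>n. A x - (A x - (\<Sum>k<n. (complex_of_real (l k) * cinner x (g k)) *\<^sub>C g k))) \<longlonglongrightarrow> A x - 0"
    by (intro tendsto_diff tendsto_const)
  then show ?thesis by (simp add: sums_def)
qed

subsection \<open>Trace class operators\<close>

text \<open>A trace norm estimate: expand \<open>A\<close> in its eigenvectors, interchange the
  sums, and apply Bessel for each eigenvector.\<close>

lemma spectral_sum_bound:
  fixes A :: "'a::complex_hilbert_space \<Rightarrow> 'a"
  assumes A: "seq_compact_map A" and sa: "is_adjoint A A" and s: "spectral_seq A g l"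
    and l: "summable (\<lambda>k. \<bar>l k\<bar>)" and e: "subnormal_seq e" and f: "subnormal_seq f"
  shows "(\<Sum>n<N. cmod (cinner (A (e n)) (f n))) \<le> (\<Sum>k. \<bar>l k\<bar>)"
proof -
  note on = spectral_seq_orthonormal[OF s]
  \<comment> \<open>A majorant of the \<open>k\<close>-th term of the expansion of
    \<open>cinner (A x) y\<close>, by the inequality between geometric and arithmetic mean; it
    separates \<open>x\<close> from \<open>y\<close>.\<close>
  define c where "c x y k = \<bar>l k\<bar> * (((cmod (cinner x (g k)))\<^sup>2 + (cmod (cinner y (g k)))\<^sup>2) / 2)"
    for x y :: 'a and k
  have sq: "(cmod (cinner x (g k)))\<^sup>2 \<le> (norm x)\<^sup>2" for x k
    using norm_cinner_le[of x "g k"] orthonormal_seq_norm[OF on] by (simp add: power_mono)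
  have sc: "summable (c x y)" for x y
  proof (rule summable_comparison_test')
    show "summable (\<lambda>k. \<bar>l k\<bar> * (((norm x)\<^sup>2 + (norm y)\<^sup>2) / 2))" by (rule summable_mult2[OF l])
    fix k
    have "\<bar>l k\<bar> * (((cmod (cinner x (g k)))\<^sup>2 + (cmod (cinner y (g k)))\<^sup>2) / 2)
        \<le> \<bar>l k\<bar> * (((norm x)\<^sup>2 + (norm y)\<^sup>2) / 2)"
      by (intro mult_left_mono divide_right_mono add_mono sq) auto
    then show "norm (c x y k) \<le> \<bar>l k\<bar> * (((norm x)\<^sup>2 + (norm y)\<^sup>2) / 2)"
      unfolding c_def by (simp only: real_norm_def) (simp add: abs_mult)
  qed
  have le: "cmod (cinner (A x) y) \<le> suminf (c x y)" for x y
  proof -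
    have "(\<lambda>k. cinner ((complex_of_real (l k) * cinner x (g k)) *\<^sub>C g k) y) sums cinner (A x) y"
      by (rule bounded_linear.sums[OF cinner_bounded_linear_left spectral_seq_sums[OF A sa s]])
    then have eq: "cinner (A x) y = (\<Sum>k. cinner ((complex_of_real (l k) * cinner x (g k)) *\<^sub>C g k) y)"
      by (rule sums_unique)
    have b: "cmod (cinner ((complex_of_real (l k) * cinner x (g k)) *\<^sub>C g k) y) \<le> c x y k" for k
    proof -
      have "cmod (cinner (g k) y) = cmod (cinner y (g k))" by (subst cinner_commute) simp
      then have "cmod (cinner ((complex_of_real (l k) * cinner x (g k)) *\<^sub>C g k) y)
          = \<bar>l k\<bar> * (cmod (cinner x (g k)) * cmod (cinner y (g k)))"
        by (simp add: cinner_scaleC_left norm_mult mult.assoc)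
      also have "\<dots> \<le> c x y k" unfolding c_def
        using sum_squares_bound[of "cmod (cinner x (g k))" "cmod (cinner y (g k))"]
        by (intro mult_left_mono) auto
      finally show ?thesis .
    qed
    show ?thesis unfolding eq by (rule norm_suminf_le[OF b sc])
  qed
  have "(\<Sum>n<N. cmod (cinner (A (e n)) (f n))) \<le> (\<Sum>n<N. suminf (c (e n) (f n)))"
    by (rule sum_mono) (rule le)
  also have "\<dots> = (\<Sum>k. \<Sum>n<N. c (e n) (f n) k)" by (rule suminf_sum[symmetric]) (rule sc)
  also have "\<dots> \<le> (\<Sum>k. \<bar>l k\<bar>)"
  proof (rule suminf_le[OF _ summable_sum[OF sc] l])
    fix k
    \<comment> \<open>Bessel with exchanged roles: the fixed vector is \<open>g k\<close>, the
      sequence is \<open>e\<close> or \<open>f\<close>.\<close>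
    have eq: "(\<Sum>n<N. (cmod (cinner (h n) (g k)))\<^sup>2) \<le> 1" if "subnormal_seq h" for h
    proof -
      have "(\<Sum>n<N. (cmod (cinner (h n) (g k)))\<^sup>2) = (\<Sum>n<N. (cmod (cinner (g k) (h n)))\<^sup>2)"
        by (subst cinner_commute) simp
      also have "\<dots> \<le> (norm (g k))\<^sup>2" by (rule bessel_finite[OF that]) simp
      finally show ?thesis by (simp add: orthonormal_seq_norm[OF on])
    qed
    have "(\<Sum>n<N. c (e n) (f n) k) = \<bar>l k\<bar> * (((\<Sum>n<N. (cmod (cinner (e n) (g k)))\<^sup>2)
        + (\<Sum>n<N. (cmod (cinner (f n) (g k)))\<^sup>2)) / 2)"
      by (simp add: c_def sum_distrib_left sum.distrib sum_divide_distrib add_divide_distrib distrib_left)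
    also have "\<dots> \<le> \<bar>l k\<bar> * 1" using eq[OF e] eq[OF f] by (intro mult_left_mono) auto
    finally show "(\<Sum>n<N. c (e n) (f n) k) \<le> \<bar>l k\<bar>" by simp
  qed
  finally show ?thesis .
qed

text \<open>Polarisation: the sesquilinear defect \<open>D\<close> vanishes on the diagonal, and
  evaluating it at \<open>x + y\<close> and \<open>x + \<i> *\<^sub>C y\<close> makes it vanish
  everywhere.\<close>

lemma positive_operator_self_adjoint:
  assumes "positive_operator Q" shows "is_adjoint Q Q"
proof -
  have lin: "bounded_linear Q" and sc: "\<And>c x. Q (c *\<^sub>C x) = c *\<^sub>C Q x"
    and pos: "\<And>x. cinner (Q x) x \<in> \<real>\<^sub>\<ge>\<^sub>0"
    using assms by (auto simp: positive_operator_def bounded_clinear_def)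
  define D where "D x y = cinner (Q x) y - cinner x (Q y)" for x y
  have D0: "D x x = 0" for x
  proof -
    have "cnj (cinner (Q x) x) = cinner (Q x) x"
      using pos[of x] by (auto simp: complex_nonneg_Reals_iff complex_eq_iff)
    then show ?thesis by (metis D_def cinner_commute diff_self)
  qed
  have "D x y = 0" for x y
  proof -
    have "D (x + y) (x + y) = D x x + D y y + (D x y + D y x)"
      by (simp add: D_def linear_simps[OF lin] cinner_linear)
    moreover have "D (x + \<i> *\<^sub>C y) (x + \<i> *\<^sub>C y) = D x x + D y y + \<i> * (D y x - D x y)"
      by (simp add: D_def linear_simps[OF lin] sc cinner_linear algebra_simps)
    ultimately have "D x y + D y x = 0" "D y x - D x y = 0" by (simp_all add: D0)
    then show ?thesis by simp
  qed
  then show ?thesis by (simp add: is_adjoint_def D_def)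
qed

text \<open>If the singular values are summable, \<open>|T|\<close> is the diagonal operator that they define on the
  eigenvectors of \<open>T\<^sup>*T\<close>.\<close>

lemma trace_class_if_summable:
  fixes T :: "'a::complex_hilbert_space \<Rightarrow> 'a"
  assumes sep: "separable_space (euclidean :: 'a topology)"
    and T: "seq_compact_map T" and T': "bounded_clinear T'" and adj: "is_adjoint T T'"
    and s: "spectral_seq (\<lambda>x. T' (T x)) e \<nu>" and sm: "summable (\<lambda>n. norm (T (e n)))"
  shows "trace_class T"
proof -
  define A where "A = (\<lambda>x. T' (T x))"
  define \<sigma> where "\<sigma> n = norm (T (e n))" for n
  have s: "spectral_seq A e \<nu>" using s by (simp add: A_def)
  note on = spectral_seq_orthonormal[OF s]
  have sub: "subnormal_seq e" by (rule orthonormal_imp_subnormal_seq[OF on])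
  have ce: "cinner (e m) (e n) = (if m = n then 1 else 0)" for m n using on by (simp add: orthonormal_seq_def)
  have sm: "summable \<sigma>" using sm by (simp add: \<sigma>_def[abs_def])
  have A: "seq_compact_map A" unfolding A_def by (rule seq_compact_map_compose[OF T' T])
  have sa: "is_adjoint A A" by (simp add: A_def is_adjoint_def is_adjointD[OF adj] is_adjointD2[OF adj])
  have AT: "cinner (A x) x = complex_of_real ((norm (T x))\<^sup>2)" for x
    by (simp add: A_def is_adjointD2[OF adj] cinner_self_eq_norm)
  have nu: "\<nu> n = (\<sigma> n)\<^sup>2" for n
    using AT[of "e n"] by (simp add: spectral_seq_eigen[OF s] cinner_scaleC_left ce \<sigma>_def del: of_real_power)
  note exp = spectral_seq_sums[OF A sa s]
  \<comment> \<open>The terms of the series for \<open>P\<close>, which has the eigenvalue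
    \<open>\<sigma> n\<close> at \<open>e n\<close>; summability of \<sigma> gives absolute
    convergence and boundedness.\<close>
  define t where "t x n = (complex_of_real (\<sigma> n) * cinner x (e n)) *\<^sub>C e n" for x n
  have nt: "norm (t x n) \<le> \<sigma> n * norm x" for x n
    using norm_cinner_le[of x "e n"]
    by (auto simp: t_def norm_scaleC norm_mult orthonormal_seq_norm[OF on] \<sigma>_def intro!: mult_left_mono)
  have snt: "summable (\<lambda>n. norm (t x n))" for x
    by (rule summable_comparison_test'[OF summable_mult2[OF sm, of "norm x"]]) (simp add: nt)
  have st: "summable (t x)" for x by (rule summable_norm_cancel[OF snt])
  define P where "P x = suminf (t x)" for x
  have Ps: "t x sums P x" for x using st by (simp add: P_def summable_sums)
  have bP: "bounded_clinear P"
    unfolding P_def[abs_def]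
  proof (rule bounded_clinear_suminf[where f = "\<lambda>n x. t x n" and K = "suminf \<sigma>"])
    show "bounded_clinear (\<lambda>x. t x n)" for n
      using bounded_clinear_scale[OF rank_one_bounded_clinear, of "complex_of_real (\<sigma> n)" "e n" "e n"]
      by (simp add: t_def scaleC_scaleC)
    show "norm (suminf (t x)) \<le> norm x * suminf \<sigma>" for x
      using norm_suminf_le[OF nt summable_mult2[OF sm]] suminf_mult2[OF sm, of "norm x"]
      by (simp add: mult.commute)
  qed (rule st)
  note linP = bounded_clinear_bounded_linear[OF bP]
  have cP: "cinner (P x) (e m) = complex_of_real (\<sigma> m) * cinner x (e m)" for x m
  proof -
    have "(\<lambda>n. cinner (t x n) (e m)) sums cinner (P x) (e m)"
      by (rule bounded_linear.sums[OF cinner_bounded_linear_left Ps])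
    moreover have "(\<lambda>n. cinner (t x n) (e m))
        = (\<lambda>n. if n = m then complex_of_real (\<sigma> n) * cinner x (e n) else 0)"
      by (auto simp: t_def cinner_scaleC_left ce)
    ultimately show ?thesis
      using sums_unique2[OF _ sums_single[of m "\<lambda>n. complex_of_real (\<sigma> n) * cinner x (e n)"]] by simp
  qed
  have PP: "P (P x) = A x" for x
  proof -
    have "t (P x) = (\<lambda>n. (complex_of_real (\<nu> n) * cinner x (e n)) *\<^sub>C e n)"
      by (auto simp: t_def cP nu power2_eq_square mult.assoc)
    then have "(\<lambda>n. (complex_of_real (\<nu> n) * cinner x (e n)) *\<^sub>C e n) sums P (P x)"
      using Ps[of "P x"] by simp
    then show ?thesis by (rule sums_unique2[OF _ exp])
  qed
  have "cinner (P x) x \<in> \<real>\<^sub>\<ge>\<^sub>0" for x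
  proof -
    have "(\<lambda>n. cinner (t x n) x) sums cinner (P x) x"
      by (rule bounded_linear.sums[OF cinner_bounded_linear_left Ps])
    moreover have "cinner (t x n) x = complex_of_real (\<sigma> n * (cmod (cinner x (e n)))\<^sup>2)" for n
      using cinner_commute[of "e n" x]
      by (simp add: t_def cinner_scaleC_left complex_norm_square mult.assoc del: of_real_power)
    ultimately have sm: "(\<lambda>n. complex_of_real (\<sigma> n * (cmod (cinner x (e n)))\<^sup>2)) sums cinner (P x) x"
      by simp
    have re: "(\<lambda>n. \<sigma> n * (cmod (cinner x (e n)))\<^sup>2) sums Re (cinner (P x) x)"
      using sums_Re[OF sm] by simp
    have im: "(\<lambda>n. 0) sums Im (cinner (P x) x)" using sums_Im[OF sm] by simp
    have "0 \<le> Re (cinner (P x) x)" by (rule sums_le[OF _ sums_zero re]) (simp add: \<sigma>_def)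
    moreover have "Im (cinner (P x) x) = 0" by (rule sums_unique2[OF im sums_zero])
    ultimately show ?thesis by (simp add: complex_nonneg_Reals_iff)
  qed
  then have posP: "positive_operator P" using bP by (simp add: positive_operator_def)
  have cadj: "cadjoint T \<circ> T = A" using cadjoint_eq[OF adj] by (simp add: A_def o_def)
  have "abs_operator T = P"
    unfolding abs_operator_def cadj
  proof (rule the_equality)
    show "positive_operator P \<and> P \<circ> P = A" using posP PP by auto
    fix Q assume Q: "positive_operator Q \<and> Q \<circ> Q = A"
    have bQ: "bounded_clinear Q" using Q by (simp add: positive_operator_def)
    note linQ = bounded_clinear_bounded_linear[OF bQ]
    have QQ: "Q (Q x) = A x" for x using Q by (auto simp: fun_eq_iff)
    have saQ: "is_adjoint Q Q" using Q by (simp add: positive_operator_self_adjoint)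
    have ker: "Q x = 0" if "A x = 0" for x
    proof -
      have "cinner (Q x) (Q x) = 0" using that by (simp add: is_adjointD[OF saQ] QQ)
      then show ?thesis by simp
    qed
    \<comment> \<open>Uniqueness of the root: \<open>Q\<close> vanishes on the kernel of
      \<open>A\<close>, so it agrees with \<open>P\<close> everywhere once it agrees on every
      \<open>e n\<close>.\<close>
    have Qe: "Q (e n) = complex_of_real (\<sigma> n) *\<^sub>C e n" for n
    proof (cases "\<sigma> n = 0")
      case True
      then have "A (e n) = 0" by (simp add: spectral_seq_eigen[OF s] nu)
      then show ?thesis using ker True by simp
    next
      case False
      then have sp: "\<sigma> n > 0" by (simp add: \<sigma>_def)
      \<comment> \<open>Because \<open>Q (Q (e n))\<close> is \<open>(\<sigma> n)\<^sup>2\<close>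
        times \<open>e n\<close>, the defect \<open>z\<close> satisfies
        \<open>Q z = - \<sigma> n z\<close>; positivity of \<open>Q\<close> then forces
        \<open>z = 0\<close>.\<close>
      define z where "z = Q (e n) - complex_of_real (\<sigma> n) *\<^sub>C e n"
      have "Q z = - (complex_of_real (\<sigma> n) *\<^sub>C z)"
        by (simp add: z_def linear_simps[OF linQ] bounded_clinear_scaleC[OF bQ] QQ
            spectral_seq_eigen[OF s] nu complex_vector.scale_right_diff_distrib scaleC_scaleC power2_eq_square)
      then have "cinner (Q z) z = complex_of_real (- (\<sigma> n * (norm z)\<^sup>2))"
        by (simp add: cinner_linear cinner_self_eq_norm)
      moreover have "cinner (Q z) z \<in> \<real>\<^sub>\<ge>\<^sub>0" using Q by (simp add: positive_operator_def)
      ultimately have "\<sigma> n * (norm z)\<^sup>2 \<le> 0" by (simp only: complex_nonneg_Reals_iff) simp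
      then have "norm z = 0" using sp by (simp add: mult_le_0_iff)
      then show ?thesis by (simp add: z_def)
    qed
    show "Q = P"
    proof
      fix x
      \<comment> \<open>The projection of \<open>x\<close> onto the closed span of the
        \<open>e n\<close>; the rest \<open>x - y\<close> lies in the kernel of \<open>A\<close>,
        hence of \<open>Q\<close>.\<close>
      define y where "y = (\<Sum>n. cinner x (e n) *\<^sub>C e n)"
      have y: "(\<lambda>n. cinner x (e n) *\<^sub>C e n) sums y"
        using diagonal_operator(1)[OF sub sub] by (simp add: y_def summable_sums)
      have "(\<lambda>n. Q (cinner x (e n) *\<^sub>C e n)) sums Q y" by (rule bounded_linear.sums[OF linQ y])
      moreover have "(\<lambda>n. Q (cinner x (e n) *\<^sub>C e n)) = t x"
        by (auto simp: t_def bounded_clinear_scaleC[OF bQ] Qe scaleC_scaleC mult.commute)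
      ultimately have "Q y = P x" using sums_unique2[OF Ps[of x]] by simp
      moreover have "cinner (x - y) (e m) = 0" for m
      proof -
        have "(\<lambda>n. cinner (cinner x (e n) *\<^sub>C e n) (e m)) sums cinner y (e m)"
          by (rule bounded_linear.sums[OF cinner_bounded_linear_left y])
        moreover have "(\<lambda>n. cinner (cinner x (e n) *\<^sub>C e n) (e m)) = (\<lambda>n. if n = m then cinner x (e n) else 0)"
          by (auto simp: cinner_scaleC_left ce)
        ultimately show ?thesis
          using sums_unique2[OF _ sums_single[of m "\<lambda>n. cinner x (e n)"]] by (simp add: cinner_diff_left)
      qed
      then have "(\<lambda>n. 0) sums A (x - y)" using exp[of "x - y"] by simp
      then have "A (x - y) = 0" by (rule sums_unique2[OF _ sums_zero])
      then have "Q x = Q y" using ker[of "x - y"] by (simp add: linear_simps[OF linQ])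
      ultimately show "Q x = P x" by simp
    qed
  qed
  moreover obtain B where B: "range e \<subseteq> B" "orthonormal_basis B"
    using orthonormal_basis_extend[OF sep orthonormal_seq_range[OF on]] by blast
  have "(\<lambda>b. cinner (P b) b) summable_on B"
  proof -
    have Pe: "cinner (P (e n)) (e n) = complex_of_real (\<sigma> n)" for n by (simp add: cP ce)
    have "(\<lambda>n. complex_of_real (\<sigma> n)) summable_on UNIV"
      by (rule norm_summable_imp_summable_on) (use sm in \<open>simp add: \<sigma>_def[abs_def]\<close>)
    then have "(\<lambda>b. cinner (P b) b) summable_on range e"
      by (subst summable_on_reindex[OF orthonormal_seq_inj[OF on]]) (simp add: o_def Pe)
    \<comment> \<open>The basis vectors added to the \<open>e n\<close> are orthogonal to all of
      them, so \<open>P\<close> annihilates these vectors and the trace only sees the singular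
      values.\<close>
    moreover have "cinner (P b) b = 0" if b: "b \<in> B - range e" for b
    proof -
      have "cinner b (e n) = 0" for n
      proof -
        have "b \<in> B" "e n \<in> B" "b \<noteq> e n" using b B(1) by auto
        then show ?thesis using orthonormal_basis_set[OF B(2)] by (simp add: orthonormal_set_def)
      qed
      then have "t b = (\<lambda>n. 0)" by (auto simp: t_def)
      then show ?thesis by (simp add: P_def)
    qed
    ultimately show ?thesis
      using summable_on_cong_neutral[of B "range e" "\<lambda>b. cinner (P b) b" "\<lambda>b. cinner (P b) b"] B(1) by auto
  qed
  ultimately show ?thesis
    using B(2) seq_compact_map_bounded_clinear[OF T] by (auto simp: trace_class_def)
qed

lemma hermitian_part_self_adjoint:
  assumes "is_adjoint T T'"
  shows "is_adjoint (\<lambda>x. c *\<^sub>C T x + cnj c *\<^sub>C T' x) (\<lambda>x. c *\<^sub>C T x + cnj c *\<^sub>C T' x)"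
  using is_adjointD[OF assms] is_adjointD2[OF assms] by (simp add: is_adjoint_def cinner_linear)

text \<open>The eigenvalue is \<open>c * cinner (T (g n)) (g n)\<close> plus its conjugate.\<close>

lemma spectral_seq_hermitian_part_le:
  assumes adj: "is_adjoint T T'" and c: "cmod c = 1"
    and s: "spectral_seq (\<lambda>x. c *\<^sub>C T x + cnj c *\<^sub>C T' x) g l"
  shows "\<bar>l n\<bar> \<le> 2 * cmod (cinner (T (g n)) (g n))"
proof -
  have gg: "cinner (g n) (g n) = 1" using spectral_seq_orthonormal[OF s] by (simp add: orthonormal_seq_def)
  have "c *\<^sub>C T (g n) + cnj c *\<^sub>C T' (g n) = complex_of_real (l n) *\<^sub>C g n"
    using spectral_seq_eigen[OF s] by simp
  then have "cinner (c *\<^sub>C T (g n) + cnj c *\<^sub>C T' (g n)) (g n) = complex_of_real (l n) * cinner (g n) (g n)"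
    by (simp add: cinner_scaleC_left)
  then have "complex_of_real (l n) = c * cinner (T (g n)) (g n) + cnj c * cinner (g n) (T (g n))"
    by (simp add: cinner_linear is_adjointD2[OF adj] gg)
  then have "\<bar>l n\<bar> \<le> cmod (c * cinner (T (g n)) (g n)) + cmod (cnj c * cinner (g n) (T (g n)))"
    by (metis norm_of_real norm_triangle_ineq real_norm_def)
  moreover have "cmod (cinner (g n) (T (g n))) = cmod (cinner (T (g n)) (g n))"
    by (subst cinner_commute) simp
  ultimately show ?thesis using c by (simp add: norm_mult)
qed

text \<open>If the eigenvalues of both Hermitian parts were summable, the trace norm estimate would
  make the singular values of \<open>T\<close> summable.\<close>

lemma not_trace_class_diagonal:
  fixes T :: "'a::complex_hilbert_space \<Rightarrow> 'a"
  assumes sep: "separable_space (euclidean :: 'a topology)"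
    and infinite_dim: "\<nexists>B :: 'a set. finite B \<and> cspan B = UNIV"
    and T: "seq_compact_map T" and T': "bounded_clinear T'" and adj: "is_adjoint T T'"
    and ntc: "\<not> trace_class T"
  shows "\<exists>g (l :: nat \<Rightarrow> real). orthonormal_seq g \<and> antimono (\<lambda>n. \<bar>l n\<bar>) \<and> \<not> summable (\<lambda>n. \<bar>l n\<bar>) \<and>
    (\<forall>n. \<bar>l n\<bar> \<le> 2 * cmod (cinner (T (g n)) (g n)))"
proof (rule ccontr)
  assume neg: "\<not> ?thesis"
  define H where "H c = (\<lambda>x. c *\<^sub>C T x + cnj c *\<^sub>C T' x)" for c
  have H: "seq_compact_map (H c)" for c
    unfolding H_def using seq_compact_map_adjoint[OF T T' adj] T
    by (intro seq_compact_map_add seq_compact_map_compose[OF bounded_clinear_scale[OF bounded_clinear_ident]])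
  have saH: "is_adjoint (H c) (H c)" for c unfolding H_def by (rule hermitian_part_self_adjoint[OF adj])
  have "\<exists>g l. spectral_seq (H c) g l \<and> summable (\<lambda>n. \<bar>l n\<bar>)" if c: "cmod c = 1" for c
  proof -
    obtain g l where gl: "spectral_seq (H c) g l" using spectral_seq_exists[OF H saH infinite_dim] by blast
    have "antimono (\<lambda>n. \<bar>l n\<bar>)" using spectral_seq_antimono[OF gl] by (simp add: antimono_def)
    moreover have "\<forall>n. \<bar>l n\<bar> \<le> 2 * cmod (cinner (T (g n)) (g n))"
      using spectral_seq_hermitian_part_le[OF adj c] gl unfolding H_def by blast
    ultimately have "summable (\<lambda>n. \<bar>l n\<bar>)" using neg spectral_seq_orthonormal[OF gl] by blast
    with gl show ?thesis by blast
  qed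
  from this[of 1] this[of \<i>] obtain g1 l1 g2 l2
    where s1: "spectral_seq (H 1) g1 l1" "summable (\<lambda>n. \<bar>l1 n\<bar>)"
      and s2: "spectral_seq (H \<i>) g2 l2" "summable (\<lambda>n. \<bar>l2 n\<bar>)" by auto
  have "seq_compact_map (\<lambda>x. T' (T x))" by (rule seq_compact_map_compose[OF T' T])
  moreover have "is_adjoint (\<lambda>x. T' (T x)) (\<lambda>x. T' (T x))"
    by (simp add: is_adjoint_def is_adjointD[OF adj] is_adjointD2[OF adj])
  ultimately obtain e \<nu> where s: "spectral_seq (\<lambda>x. T' (T x)) e \<nu>"
    using spectral_seq_exists[OF _ _ infinite_dim] by blast
  note on = spectral_seq_orthonormal[OF s]
  \<comment> \<open>The partial isometry of the polar decomposition maps \<open>e n\<close> to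
    \<open>f n\<close>. Where \<open>T (e n) = 0\<close>, division by zero makes the factor and
    \<open>f n\<close> zero.\<close>
  define f where "f n = complex_of_real (1 / norm (T (e n))) *\<^sub>C T (e n)" for n
  have "cinner (T (e m)) (T (e n)) = 0" if "m \<noteq> n" for m n
    using that on by (simp add: is_adjointD2[OF adj, symmetric] spectral_seq_eigen[OF s]
        cinner_scaleC_left orthonormal_seq_def)
  then have f: "subnormal_seq f"
    by (auto simp: subnormal_seq_def f_def norm_scaleC norm_divide cinner_linear)
  have e: "subnormal_seq e" by (rule orthonormal_imp_subnormal_seq[OF on])
  have "(\<Sum>n<N. norm (T (e n))) \<le> (\<Sum>k. \<bar>l1 k\<bar>) + (\<Sum>k. \<bar>l2 k\<bar>)" for N
  proof -
    have "norm (T (e n)) \<le> cmod (cinner (H 1 (e n)) (f n)) + cmod (cinner (H \<i> (e n)) (f n))" for n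
    proof -
      have "complex_of_real (norm (T (e n))) = cinner (T (e n)) (f n)"
        by (cases "T (e n) = 0") (simp_all add: f_def cinner_linear cinner_self_eq_norm power2_eq_square)
      \<comment> \<open>\<open>T\<close> is half of \<open>H 1 - \<i> * H \<i>\<close>.\<close>
      also have "\<dots> = (cinner (H 1 (e n)) (f n) - \<i> * cinner (H \<i> (e n)) (f n)) / 2"
        by (simp add: H_def cinner_linear algebra_simps)
      finally have "norm (T (e n)) = cmod ((cinner (H 1 (e n)) (f n) - \<i> * cinner (H \<i> (e n)) (f n)) / 2)"
        by (metis norm_of_real abs_norm_cancel)
      also have "\<dots> \<le> (cmod (cinner (H 1 (e n)) (f n)) + cmod (\<i> * cinner (H \<i> (e n)) (f n))) / 2"
        by (simp only: norm_divide norm_numeral) (intro divide_right_mono norm_triangle_ineq4, simp)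
      also have "\<dots> \<le> cmod (cinner (H 1 (e n)) (f n)) + cmod (cinner (H \<i> (e n)) (f n))"
        by (simp add: norm_mult)
      finally show ?thesis .
    qed
    then have "(\<Sum>n<N. norm (T (e n)))
        \<le> (\<Sum>n<N. cmod (cinner (H 1 (e n)) (f n))) + (\<Sum>n<N. cmod (cinner (H \<i> (e n)) (f n)))"
      by (simp add: sum_mono flip: sum.distrib)
    also have "\<dots> \<le> (\<Sum>k. \<bar>l1 k\<bar>) + (\<Sum>k. \<bar>l2 k\<bar>)"
      by (intro add_mono spectral_sum_bound[OF H saH s1 e f] spectral_sum_bound[OF H saH s2 e f])
    finally show ?thesis .
  qed
  then have "(\<Sum>n\<le>N. norm (T (e n))) \<le> (\<Sum>k. \<bar>l1 k\<bar>) + (\<Sum>k. \<bar>l2 k\<bar>)" for N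
    by (metis lessThan_Suc_atMost)
  then have "summable (\<lambda>n. norm (T (e n)))" by (intro bounded_imp_summable) auto
  then have "trace_class T" by (rule trace_class_if_summable[OF sep T T' adj s])
  with ntc show False by simp
qed

subsection \<open>Pairs with large off-diagonal entries\<close>

lemma eventually_strict_mono_choice:
  assumes "\<And>j :: nat. eventually (P j) sequentially"
  shows "\<exists>r :: nat \<Rightarrow> nat. strict_mono r \<and> (\<forall>j. P j (r j))"
proof -
  have "\<exists>y. P j y \<and> k < y" for j k
    using eventually_happens[OF eventually_conj[OF assms[of j] eventually_gt_at_top[of k]]] by simp
  then have "\<exists>r. \<forall>j. P j (r j) \<and> r j < r (Suc j)"
    by (intro dependent_nat_choice[where P = P and Q = "\<lambda>_ x y. x < y"]) blast+
  then show ?thesis by (auto simp: strict_mono_Suc_iff)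
qed

text \<open>By monotonicity each triple of terms is at most three times its first. Divergence thus
  survives on one residue class, and the other two are free for other uses.\<close>

lemma not_summable_subsequence_3:
  fixes l :: "nat \<Rightarrow> real"
  assumes mono: "antimono (\<lambda>n. \<bar>l n\<bar>)" and ns: "\<not> summable (\<lambda>n. \<bar>l n\<bar>)"
  shows "\<not> summable (\<lambda>j. \<bar>l (3 * j)\<bar>)"
proof
  assume s: "summable (\<lambda>j. \<bar>l (3 * j)\<bar>)"
  have le: "(\<Sum>n<3*N. \<bar>l n\<bar>) \<le> 3 * (\<Sum>j<N. \<bar>l (3 * j)\<bar>)" for N
  proof (induction N)
    case (Suc N)
    have "(\<Sum>n<3 * Suc N. \<bar>l n\<bar>) = (\<Sum>n<3 * N. \<bar>l n\<bar>) + \<bar>l (3 * N)\<bar> + \<bar>l (Suc (3 * N))\<bar> + \<bar>l (Suc (Suc (3 * N)))\<bar>"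
      by (simp add: numeral_3_eq_3)
    moreover have "\<bar>l (Suc (3 * N))\<bar> \<le> \<bar>l (3 * N)\<bar>" "\<bar>l (Suc (Suc (3 * N)))\<bar> \<le> \<bar>l (3 * N)\<bar>"
      using antimonoD[OF mono] by auto
    ultimately show ?case using Suc by simp
  qed simp
  have "(\<Sum>n\<le>N. \<bar>l n\<bar>) \<le> 3 * (\<Sum>j. \<bar>l (3 * j)\<bar>)" for N
  proof -
    have "(\<Sum>n\<le>N. \<bar>l n\<bar>) \<le> (\<Sum>n<3 * Suc N. \<bar>l n\<bar>)" by (rule sum_mono2) auto
    also have "\<dots> \<le> 3 * (\<Sum>j<Suc N. \<bar>l (3 * j)\<bar>)" by (rule le)
    also have "\<dots> \<le> 3 * (\<Sum>j. \<bar>l (3 * j)\<bar>)" by (intro mult_left_mono sum_le_suminf[OF s]) auto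
    finally show ?thesis .
  qed
  then have "summable (\<lambda>n. \<bar>l n\<bar>)" by (intro bounded_imp_summable) auto
  with ns show False by simp
qed

text \<open>Rotating a vector \<open>e\<close> with a large diagonal entry \<open>\<alpha>\<close> by a small angle, with sine \<open>\<phi> = \<theta>/2\<close>,
  against a vector \<open>f\<close> that \<open>T\<close> almost annihilates gives an off-diagonal entry of size
  \<open>\<phi>\<bar>\<alpha>\<bar>\<close> next to a diagonal entry of size \<open>\<phi>\<^sup>2\<bar>\<alpha>\<bar>\<close>.\<close>

lemma rotated_pair_estimate:
  fixes \<alpha> b c d :: complex
  assumes \<theta>: "0 < \<theta>" "\<theta> < 1" and \<phi>: "\<phi> = \<theta> / 2" and \<kappa>: "\<kappa> = sqrt (1 - \<phi>\<^sup>2)"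
    and small: "cmod b \<le> \<theta>\<^sup>2 / 64 * cmod \<alpha>" "cmod c \<le> \<theta>\<^sup>2 / 64 * cmod \<alpha>" "cmod d \<le> \<theta>\<^sup>2 / 64 * cmod \<alpha>"
  shows "\<theta>\<^sup>2 / 32 * cmod \<alpha> \<le>
    \<theta> * cmod (complex_of_real (\<kappa> * \<phi>) * \<alpha> + complex_of_real (\<kappa>\<^sup>2) * b
        - complex_of_real (\<phi>\<^sup>2) * c - complex_of_real (\<phi> * \<kappa>) * d)
    - cmod (complex_of_real (\<phi>\<^sup>2) * \<alpha> + complex_of_real (\<phi> * \<kappa>) * b
        + complex_of_real (\<phi> * \<kappa>) * c + complex_of_real (\<kappa>\<^sup>2) * d)"
proof -
  define \<eta> where "\<eta> = \<theta>\<^sup>2 / 64 * cmod \<alpha>"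
  have \<eta>: "\<eta> \<ge> 0" by (simp add: \<eta>_def)
  have p: "0 < \<phi>" "\<phi> \<le> 1/2" using \<theta> \<phi> by auto
  have p2: "\<phi>\<^sup>2 \<le> (1/2)\<^sup>2" using p by (intro power_mono) auto
  have k1: "3/4 \<le> \<kappa>" unfolding \<kappa> by (rule real_le_rsqrt) (use p2 in \<open>simp add: power2_eq_square\<close>)
  have k2: "\<kappa> \<le> 1" unfolding \<kappa> by simp
  have bnd: "cmod (complex_of_real r * z) \<le> \<eta>" if "0 \<le> r" "r \<le> 1" "cmod z \<le> \<eta>" for r z
  proof -
    have "r * cmod z \<le> 1 * \<eta>" using that by (intro mult_mono) auto
    then show ?thesis using that(1) by (simp add: norm_mult)
  qed
  have r: "\<phi>\<^sup>2 \<le> 1" "\<kappa>\<^sup>2 \<le> 1" "0 \<le> \<phi> * \<kappa>" "\<phi> * \<kappa> \<le> 1"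
    using p k1 k2 by (auto intro: power_le_one mult_le_one)
  have s: "cmod b \<le> \<eta>" "cmod c \<le> \<eta>" "cmod d \<le> \<eta>" using small by (simp_all add: \<eta>_def)
  define X where "X = complex_of_real (\<kappa> * \<phi>) * \<alpha>"
  define Y where "Y = complex_of_real (\<phi>\<^sup>2) * \<alpha>"
  have X: "cmod X = \<kappa> * \<phi> * cmod \<alpha>" using p k1 by (simp add: X_def norm_mult)
  have Y: "cmod Y = \<phi>\<^sup>2 * cmod \<alpha>" by (simp add: Y_def norm_mult norm_power)
  have tri1: "cmod X - 3 * \<eta> \<le> cmod (X + b' - c' - d')"
    if "cmod b' \<le> \<eta>" "cmod c' \<le> \<eta>" "cmod d' \<le> \<eta>" for b' c' d'
  proof -
    have "cmod X \<le> cmod (X + b' - c' - d') + cmod (b' - c' - d')"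
      using norm_triangle_ineq4[of "X + b' - c' - d'" "b' - c' - d'"] by simp
    then show ?thesis
      using norm_triangle_ineq4[of "b' - c'" d'] norm_triangle_ineq4[of b' c'] that by linarith
  qed
  have tri2: "cmod (Y + b' + c' + d') \<le> cmod Y + 3 * \<eta>"
    if "cmod b' \<le> \<eta>" "cmod c' \<le> \<eta>" "cmod d' \<le> \<eta>" for b' c' d'
  proof -
    show ?thesis
      using norm_triangle_ineq[of "Y + b' + c'" d'] norm_triangle_ineq[of "Y + b'" c']
        norm_triangle_ineq[of Y b'] that by linarith
  qed
  have "\<theta> * (cmod X - 3 * \<eta>) - (cmod Y + 3 * \<eta>)
      \<le> \<theta> * cmod (X + complex_of_real (\<kappa>\<^sup>2) * b - complex_of_real (\<phi>\<^sup>2) * c - complex_of_real (\<phi> * \<kappa>) * d)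
       - cmod (Y + complex_of_real (\<phi> * \<kappa>) * b + complex_of_real (\<phi> * \<kappa>) * c + complex_of_real (\<kappa>\<^sup>2) * d)"
    using \<theta> by (intro diff_mono mult_left_mono tri1 tri2 bnd s r zero_le_power2) auto
  \<comment> \<open>With \<open>\<kappa> \<ge> 3/4\<close> the main terms contribute at least
    \<open>3/8 - 1/4 = 1/8\<close> and the errors at most \<open>6/64\<close>, in units of
    \<open>\<theta>\<^sup>2 * cmod \<alpha>\<close>; this leaves \<open>1/32\<close>.\<close>
  moreover have "\<theta>\<^sup>2 / 32 * cmod \<alpha> \<le> \<theta> * (cmod X - 3 * \<eta>) - (cmod Y + 3 * \<eta>)"
  proof -
    have "3/4 * (\<theta> * \<phi> * cmod \<alpha>) \<le> \<kappa> * (\<theta> * \<phi> * cmod \<alpha>)"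
      using k1 \<theta> p by (intro mult_right_mono) auto
    moreover have "\<theta> * \<eta> \<le> \<eta>" using \<theta> \<eta> by (simp add: mult_left_le_one_le)
    ultimately show ?thesis unfolding X Y by (simp add: \<eta>_def \<phi> power2_eq_square algebra_simps)
  qed
  ultimately show ?thesis unfolding X_def Y_def by linarith
qed

text \<open>Indices are split modulo 3: \<open>e\<close> carries the large diagonal entries,
  partners are drawn from \<open>q\<close>, where \<open>T\<close> becomes small, and
  \<open>h\<close> is set aside to keep the complement of all \<open>u j\<close> and
  \<open>v j\<close> infinite-dimensional.\<close>

lemma rotated_pairs_exist:
  fixes T :: "'a::complex_hilbert_space \<Rightarrow> 'a"
  assumes T: "seq_compact_map T" and adj: "is_adjoint T T'"
    and g: "orthonormal_seq g" and mono: "antimono (\<lambda>n. \<bar>l n :: real\<bar>)"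
    and ns: "\<not> summable (\<lambda>n. \<bar>l n\<bar>)" and le: "\<And>n. \<bar>l n\<bar> \<le> 2 * cmod (cinner (T (g n)) (g n))"
    and \<theta>: "0 < \<theta>" "\<theta> < 1"
  shows "\<exists>u v h. orthonormal_seq u \<and> orthonormal_seq v \<and> orthonormal_seq h \<and>
    (\<forall>i j. cinner (u i) (v j) = 0) \<and> (\<forall>i j. cinner (u i) (h j) = 0) \<and> (\<forall>i j. cinner (v i) (h j) = 0) \<and>
    (\<forall>j. 0 < \<theta> * cmod (cinner (T (u j)) (v j)) - cmod (cinner (T (v j)) (v j))) \<and>
    \<not> summable (\<lambda>j. \<theta> * cmod (cinner (T (u j)) (v j)) - cmod (cinner (T (v j)) (v j)))"
proof -
  have bT: "bounded_clinear T" by (rule seq_compact_map_bounded_clinear[OF T])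
  note lin = bounded_clinear_bounded_linear[OF bT]
  note sc = bounded_clinear_scaleC[OF bT]
  define e where "e j = g (3 * j)" for j
  define q where "q i = g (3 * i + 1)" for i
  define h where "h j = g (3 * j + 2)" for j
  define \<alpha> where "\<alpha> j = cinner (T (e j)) (e j)" for j
  have gg: "cinner (g m) (g n) = (if m = n then 1 else 0)" for m n using g by (simp add: orthonormal_seq_def)
  have q: "orthonormal_seq q"
    unfolding q_def by (rule orthonormal_seq_comp[OF g, of "\<lambda>i. 3 * i + 1"]) (simp add: inj_def)
  have h: "orthonormal_seq h"
    unfolding h_def by (rule orthonormal_seq_comp[OF g, of "\<lambda>i. 3 * i + 2"]) (simp add: inj_def)
  \<comment> \<open>A zero value would, by monotonicity, make the sequence eventually zero and hence
    summable. Nonzero values give each \<open>e j\<close> a positive tolerance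
    \<open>\<eta> j\<close>.\<close>
  have l0: "l n \<noteq> 0" for n
  proof
    assume n: "l n = 0"
    have "\<bar>l k\<bar> = 0" if "k \<ge> n" for k using antimonoD[OF mono that] n by simp
    then have "summable (\<lambda>k. \<bar>l k\<bar>) = summable (\<lambda>k. 0 :: real)"
      by (intro summable_cong) (auto simp: eventually_sequentially)
    then show False using ns by simp
  qed
  have \<alpha>l: "\<bar>l (3 * j)\<bar> \<le> 2 * cmod (\<alpha> j)" for j using le by (simp add: \<alpha>_def e_def)
  have \<alpha>0: "0 < cmod (\<alpha> j)" for j using \<alpha>l[of j] l0[of "3 * j"] by auto
  define \<eta> where "\<eta> j = \<theta>\<^sup>2 / 64 * cmod (\<alpha> j)" for j
  have \<eta>: "0 < \<eta> j" for j using \<alpha>0 \<theta> by (simp add: \<eta>_def)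
  define small where "small j i \<longleftrightarrow> cmod (cinner (T (e j)) (q i)) \<le> \<eta> j \<and>
    cmod (cinner (T (q i)) (e j)) \<le> \<eta> j \<and> cmod (cinner (T (q i)) (q i)) \<le> \<eta> j" for j i
  have "eventually (small j) sequentially" for j
  proof -
    have small_ev: "\<forall>\<^sub>F i in sequentially. cmod (z i) \<le> \<eta> j" if "z \<longlonglongrightarrow> 0" for z
      using order_tendstoD(2)[OF tendsto_norm_zero[OF that] \<eta>[of j]] by eventually_elim simp
    have Tq: "(\<lambda>i. T (q i)) \<longlonglongrightarrow> 0" by (rule seq_compact_map_orthonormal_tendsto_0[OF T adj q])
    have 1: "(\<lambda>i. cinner (T (e j)) (q i)) \<longlonglongrightarrow> 0"
      by (rule cinner_orthonormal_tendsto_0[OF orthonormal_imp_subnormal_seq[OF q]])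
    have 2: "(\<lambda>i. cinner (T (q i)) (e j)) \<longlonglongrightarrow> 0"
      using tendsto_cinner[OF Tq tendsto_const[of "e j"]] by simp
    have 3: "(\<lambda>i. cinner (T (q i)) (q i)) \<longlonglongrightarrow> 0"
    proof (rule Lim_null_comparison[OF _ tendsto_norm_zero[OF Tq]])
      show "\<forall>\<^sub>F i in sequentially. cmod (cinner (T (q i)) (q i)) \<le> norm (T (q i))"
      proof (rule always_eventually, rule allI)
        fix i show "cmod (cinner (T (q i)) (q i)) \<le> norm (T (q i))"
          using norm_cinner_le[of "T (q i)" "q i"] by (simp add: orthonormal_seq_norm[OF q])
      qed
    qed
    show ?thesis
      unfolding small_def by (intro eventually_conj small_ev 1 2 3)
  qed
  \<comment> \<open>Strict monotonicity of \<open>r\<close> keeps the partners \<open>f j\<close>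
    distinct, hence orthonormal.\<close>
  then obtain r :: "nat \<Rightarrow> nat" where r: "strict_mono r" "\<And>j. small j (r j)"
    using eventually_strict_mono_choice by blast
  define f where "f j = q (r j)" for j
  define \<phi> where "\<phi> = \<theta> / 2"
  define \<kappa> where "\<kappa> = sqrt (1 - \<phi>\<^sup>2)"
  define F where "F = complex_of_real \<phi>"
  define K where "K = complex_of_real \<kappa>"
  have "\<phi>\<^sup>2 \<le> 1" using \<theta> by (auto simp: \<phi>_def intro!: power_le_one)
  then have "\<kappa>\<^sup>2 + \<phi>\<^sup>2 = 1" by (simp add: \<kappa>_def)
  then have KF: "K * K + F * F = 1"
    unfolding K_def F_def by (metis of_real_1 of_real_add of_real_mult power2_eq_square)
  have cnj: "cnj K = K" "cnj F = F" by (simp_all add: K_def F_def)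
  define u where "u j = K *\<^sub>C e j - F *\<^sub>C f j" for j
  define v where "v j = F *\<^sub>C e j + K *\<^sub>C f j" for j
  have rinj: "r i = r j \<longleftrightarrow> i = j" for i j using r(1) by (simp add: strict_mono_eq)
  have tab: "cinner (e i) (e j) = (if i = j then 1 else 0)" "cinner (f i) (f j) = (if i = j then 1 else 0)"
    "cinner (e i) (f j) = 0" "cinner (f i) (e j) = 0" "cinner (e i) (h j) = 0" "cinner (f i) (h j) = 0" for i j
    by (simp_all add: e_def f_def q_def h_def gg rinj, presburger+)
  have u: "orthonormal_seq u"
    unfolding orthonormal_seq_def u_def using KF by (simp add: cinner_linear tab cnj)
  have v: "orthonormal_seq v"
    unfolding orthonormal_seq_def v_def using KF by (simp add: cinner_linear tab cnj add.commute)
  have uv: "cinner (u i) (v j) = 0" for i j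
    by (simp add: u_def v_def cinner_linear tab cnj)
  have uh: "cinner (u i) (h j) = 0" "cinner (v i) (h j) = 0" for i j
    by (simp_all add: u_def v_def cinner_linear tab)
  define \<rho> where "\<rho> j = \<theta> * cmod (cinner (T (u j)) (v j)) - cmod (cinner (T (v j)) (v j))" for j
  have ge: "\<theta>\<^sup>2 / 32 * cmod (\<alpha> j) \<le> \<rho> j" for j
  proof -
    define b where "b = cinner (T (e j)) (f j)"
    define c where "c = cinner (T (f j)) (e j)"
    define d where "d = cinner (T (f j)) (f j)"
    have 1: "cinner (T (u j)) (v j) = complex_of_real (\<kappa> * \<phi>) * \<alpha> j + complex_of_real (\<kappa>\<^sup>2) * b
        - complex_of_real (\<phi>\<^sup>2) * c - complex_of_real (\<phi> * \<kappa>) * d"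
      by (simp add: u_def v_def \<alpha>_def b_def c_def d_def linear_simps[OF lin] sc cinner_linear cnj
          power2_eq_square algebra_simps flip: K_def F_def)
    have 2: "cinner (T (v j)) (v j) = complex_of_real (\<phi>\<^sup>2) * \<alpha> j + complex_of_real (\<phi> * \<kappa>) * b
        + complex_of_real (\<phi> * \<kappa>) * c + complex_of_real (\<kappa>\<^sup>2) * d"
      by (simp add: v_def \<alpha>_def b_def c_def d_def linear_simps[OF lin] sc cinner_linear cnj
          power2_eq_square algebra_simps flip: K_def F_def)
    have "small j (r j)" by (rule r(2))
    then have "cmod b \<le> \<theta>\<^sup>2 / 64 * cmod (\<alpha> j)" "cmod c \<le> \<theta>\<^sup>2 / 64 * cmod (\<alpha> j)"
      "cmod d \<le> \<theta>\<^sup>2 / 64 * cmod (\<alpha> j)"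
      by (auto simp: small_def b_def c_def d_def f_def \<eta>_def)
    then show ?thesis unfolding \<rho>_def 1 2 by (rule rotated_pair_estimate[OF \<theta> \<phi>_def \<kappa>_def])
  qed
  have pos: "0 < \<rho> j" for j
    by (rule less_le_trans[OF _ ge]) (use \<alpha>0 \<theta> in simp)
  have "\<not> summable \<rho>"
  proof
    assume s: "summable \<rho>"
    have "summable (\<lambda>j. \<bar>l (3 * j)\<bar>)"
    proof (rule summable_comparison_test'[OF summable_mult[OF s, of "64 / \<theta>\<^sup>2"]])
      fix j
      \<comment> \<open>The factor \<open>64 / \<theta>\<^sup>2\<close> combines the 2 relating
        \<open>l\<close> to \<alpha> with the \<open>\<theta>\<^sup>2 / 32\<close> of the pair
        estimate.\<close>
      have "\<bar>l (3 * j)\<bar> \<le> 64 / \<theta>\<^sup>2 * (\<theta>\<^sup>2 / 32 * cmod (\<alpha> j))" using \<alpha>l[of j] \<theta> by simp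
      also have "\<dots> \<le> 64 / \<theta>\<^sup>2 * \<rho> j" by (rule mult_left_mono[OF ge]) simp
      finally show "norm \<bar>l (3 * j)\<bar> \<le> 64 / \<theta>\<^sup>2 * \<rho> j" by simp
    qed
    then show False using not_summable_subsequence_3[OF mono ns] by simp
  qed
  then show ?thesis using u v h uv uh pos unfolding \<rho>_def by blast
qed

subsection \<open>Zero diagonals of finite blocks\<close>

text \<open>The imaginary part is a real linear functional of the complex number in place of
  \<omega>, so it has a nonzero zero in the plane, which can be normalised.\<close>

lemma exists_phase:
  fixes m n :: complex
  shows "\<exists>\<omega>. cmod \<omega> = 1 \<and> Im (\<omega> * m + cnj \<omega> * n) = 0"
proof (cases "Complex (Re (m - n)) (- Im (m + n)) = 0")
  case True
  then have "Im (m + n) = 0" by (simp add: complex_eq_iff)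
  then show ?thesis by (intro exI[of _ 1]) simp
next
  case False
  define z where "z = Complex (Re (m - n)) (- Im (m + n))"
  have z: "Im (z * m + cnj z * n) = 0" by (simp add: z_def algebra_simps)
  define r where "r = 1 / cmod z"
  have "complex_of_real r * z * m + cnj (complex_of_real r * z) * n = complex_of_real r * (z * m + cnj z * n)"
    by (simp add: algebra_simps)
  then have "Im (complex_of_real r * z * m + cnj (complex_of_real r * z) * n) = 0"
    using z by (simp only: Im_complex_of_real times_complex.sel)
  moreover have "cmod (complex_of_real r * z) = 1"
    using False unfolding z_def[symmetric] by (simp add: r_def norm_mult norm_divide)
  ultimately show ?thesis by blast
qed

text \<open>A phase on \<open>v\<close> makes the cross terms a real multiple of \<alpha>. Along a
  real rotation the diagonal entry is then \<alpha> times a continuous real function, whose endpoint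
  values have opposite signs.\<close>

lemma rotate_zero_diagonal:
  fixes R :: "'a::complex_inner \<Rightarrow> 'a" and p q :: real
  assumes R: "bounded_clinear R" and x: "norm x = 1" and v: "norm v = 1" and xv: "cinner x v = 0"
    and Rx: "cinner (R x) x = complex_of_real p * \<alpha>" and Rv: "cinner (R v) v = - complex_of_real q * \<alpha>"
    and "0 \<le> p" "0 \<le> q"
  shows "\<exists>y z. norm y = 1 \<and> norm z = 1 \<and> cinner y z = 0 \<and> cinner (R y) y = 0
    \<and> cinner (R z) z = complex_of_real (p - q) * \<alpha>
    \<and> {y, z} \<subseteq> cspan {x, v} \<and> {x, v} \<subseteq> cspan {y, z}"
proof (cases "\<alpha> = 0")
  case True
  then show ?thesis using assms complex_vector.span_superset[of "{x, v}"]
    by (intro exI[of _ x] exI[of _ v]) auto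
next
  case False
  note lin = bounded_clinear_bounded_linear[OF R]
  note sc = bounded_clinear_scaleC[OF R]
  obtain \<omega> where \<omega>: "cmod \<omega> = 1"
    "Im (\<omega> * (cinner (R v) x / \<alpha>) + cnj \<omega> * (cinner (R x) v / \<alpha>)) = 0"
    using exists_phase by blast
  have \<omega>1: "\<omega> * cnj \<omega> = 1" using \<omega>(1) by (simp add: complex_norm_square[symmetric])
  define r where "r = Re (\<omega> * (cinner (R v) x / \<alpha>) + cnj \<omega> * (cinner (R x) v / \<alpha>))"
  define w where "w = \<omega> *\<^sub>C v"
  have "\<omega> * (cinner (R v) x / \<alpha>) + cnj \<omega> * (cinner (R x) v / \<alpha>) = complex_of_real r"
    using \<omega>(2) by (simp add: r_def complex_eq_iff)
  then have cross: "cinner (R w) x + cinner (R x) w = complex_of_real r * \<alpha>"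
    using False by (simp add: w_def sc cinner_linear field_simps)
  have Rw: "cinner (R w) w = - complex_of_real q * \<alpha>"
  proof -
    have "cinner (R w) w = \<omega> * cnj \<omega> * cinner (R v) v" by (simp add: w_def sc cinner_linear)
    then show ?thesis by (simp add: \<omega>1 Rv)
  qed
  have ww: "cinner x x = 1" "cinner w w = 1" "cinner x w = 0" "cinner w x = 0"
    unfolding cinner_self_eq_1 using x v xv \<omega>(1) cinner_eq_0_commute[of x v]
    by (simp_all add: w_def norm_scaleC cinner_linear)
  \<comment> \<open>\<open>F\<close> runs from \<open>p\<close> at 0 to \<open>- q\<close> at
    \<open>pi / 2\<close>.\<close>
  define F where "F s = (cos s)\<^sup>2 * p - (sin s)\<^sup>2 * q + cos s * sin s * r" for s
  have "\<exists>s\<ge>0. s \<le> pi / 2 \<and> F s = 0"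
    unfolding F_def by (rule IVT2') (use assms(7,8) in \<open>auto intro!: continuous_intros\<close>)
  then obtain s where s: "F s = 0" by blast
  define C where "C = complex_of_real (cos s)"
  define S where "S = complex_of_real (sin s)"
  have cnj: "cnj C = C" "cnj S = S" by (simp_all add: C_def S_def)
  have CS: "C * C + S * S = 1"
    unfolding C_def S_def by (metis of_real_1 of_real_add of_real_mult power2_eq_square sin_cos_squared_add2)
  define y where "y = C *\<^sub>C x + S *\<^sub>C w"
  define z where "z = S *\<^sub>C x - C *\<^sub>C w"
  have "cinner y y = 1" "cinner z z = 1" "cinner y z = 0"
    using CS by (simp_all add: y_def z_def cinner_linear ww cnj add.commute)
  moreover have Ry: "cinner (R y) y = complex_of_real (F s) * \<alpha>"
  proof -
    have "cinner (R y) y = C * C * cinner (R x) x + S * S * cinner (R w) w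
        + C * S * (cinner (R w) x + cinner (R x) w)"
      by (simp add: y_def linear_simps[OF lin] sc cinner_linear cnj algebra_simps)
    then show ?thesis
      unfolding Rx Rw cross F_def C_def S_def by (simp add: power2_eq_square algebra_simps)
  qed
  \<comment> \<open>The rotation preserves the trace of the compression to the plane, so the second
    entry is the whole of it.\<close>
  moreover have "cinner (R z) z = complex_of_real (p - q) * \<alpha>"
  proof -
    have "cinner (R y) y + cinner (R z) z = (C * C + S * S) * (cinner (R x) x + cinner (R w) w)"
      by (simp add: y_def z_def linear_simps[OF lin] sc cinner_linear cnj algebra_simps)
    then show ?thesis unfolding CS Rx Rw Ry s by (simp add: algebra_simps)
  qed
  moreover have "{y, z} \<subseteq> cspan {x, v}"
    unfolding y_def z_def w_def
    by (auto intro!: complex_vector.span_add complex_vector.span_diff complex_vector.span_scale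
        intro: complex_vector.span_base)
  moreover have "{x, v} \<subseteq> cspan {y, z}"
  proof -
    have "C *\<^sub>C y + S *\<^sub>C z = (C * C + S * S) *\<^sub>C x"
      by (simp add: y_def z_def scaleC_add_right complex_vector.scale_right_diff_distrib
          scaleC_scaleC scaleC_add_left mult.commute)
    then have 1: "x = C *\<^sub>C y + S *\<^sub>C z" using CS by (simp add: scaleC_one)
    have "S *\<^sub>C y - C *\<^sub>C z = (C * C + S * S) *\<^sub>C w"
      by (simp add: y_def z_def scaleC_add_right complex_vector.scale_right_diff_distrib
          scaleC_scaleC scaleC_add_left mult.commute)
    then have "cnj \<omega> *\<^sub>C (S *\<^sub>C y - C *\<^sub>C z) = (\<omega> * cnj \<omega>) *\<^sub>C v"
      using CS by (simp add: scaleC_one w_def scaleC_scaleC mult.commute)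
    then have 2: "v = cnj \<omega> *\<^sub>C (S *\<^sub>C y - C *\<^sub>C z)" by (simp add: \<omega>1 scaleC_one)
    have "x \<in> cspan {y, z}"
      by (subst 1) (auto intro!: complex_vector.span_add complex_vector.span_scale intro: complex_vector.span_base)
    moreover have "v \<in> cspan {y, z}"
      by (subst 2) (auto intro!: complex_vector.span_diff complex_vector.span_scale intro: complex_vector.span_base)
    ultimately show ?thesis by simp
  qed
  ultimately show ?thesis
    using s by (intro exI[of _ y] exI[of _ z]) (simp add: cinner_self_eq_1)
qed

lemma cspan_subset: "X \<subseteq> cspan Y \<Longrightarrow> cspan X \<subseteq> cspan Y"
  by (rule complex_vector.span_minimal) (auto intro: complex_vector.subspace_span)

lemma cspan_orthogonal:
  assumes "\<And>e f. e \<in> X \<Longrightarrow> f \<in> Y \<Longrightarrow> cinner e f = 0" and x: "x \<in> cspan X" and y: "y \<in> cspan Y"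
  shows "cinner x y = 0"
proof -
  have sub: "complex_vector.subspace {x. cinner x f = 0}" for f :: 'a
    by (auto simp: complex_vector.subspace_def cinner_linear)
  have "cspan X \<subseteq> {x. cinner x f = 0}" if "f \<in> Y" for f
    by (rule complex_vector.span_minimal[OF _ sub]) (use assms(1) that in auto)
  then have "Y \<subseteq> {y. cinner y x = 0}" using x cinner_eq_0_commute[of _ x] by blast
  then have "cspan Y \<subseteq> {y. cinner y x = 0}" by (rule complex_vector.span_minimal[OF _ sub])
  then show ?thesis using y cinner_eq_0_commute[of x] by blast
qed

text \<open>Rotating \<open>x\<close> against one \<open>v\<close> leaves a vector \<open>y\<close>
  with zero entry and a vector \<open>z\<close> carrying the remaining weight; \<open>z\<close>
  replaces \<open>x\<close> in the induction. Both span inclusions are carried along so that no part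
  of the block is lost.\<close>

lemma block_zero_diagonal:
  fixes R :: "'a::complex_inner \<Rightarrow> 'a" and t :: "'a \<Rightarrow> real"
  assumes R: "bounded_clinear R" and "finite V"
    and "orthonormal_set (insert x V)" "x \<notin> V"
    and "\<And>v. v \<in> V \<Longrightarrow> 0 \<le> t v" "\<And>v. v \<in> V \<Longrightarrow> cinner (R v) v = - complex_of_real (t v) * \<alpha>"
    and "cinner (R x) x = complex_of_real (\<Sum>v\<in>V. t v) * \<alpha>"
  shows "\<exists>Y. orthonormal_set Y \<and> (\<forall>y\<in>Y. cinner (R y) y = 0) \<and>
    Y \<subseteq> cspan (insert x V) \<and> insert x V \<subseteq> cspan Y"
  using assms(2-)
proof (induction V arbitrary: x rule: finite_induct)
  case empty
  then show ?case using complex_vector.span_superset[of "{x}"] by (intro exI[of _ "{x}"]) auto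
next
  case (insert v V)
  have on: "orthonormal_set (insert x (insert v V))" by (rule insert.prems)
  have nx: "norm x = 1" and nv: "norm v = 1" using orthonormal_set_norm[OF on] by auto
  have xv: "cinner x v = 0" using on insert.prems(2) by (auto simp: orthonormal_set_def)
  have t: "0 \<le> t v" "0 \<le> (\<Sum>u\<in>insert v V. t u)"
    using insert.prems(3) by (auto intro: sum_nonneg)
  have Rv: "cinner (R v) v = - complex_of_real (t v) * \<alpha>" using insert.prems(4) by simp
  obtain y z where yz: "norm y = 1" "norm z = 1" "cinner y z = 0" "cinner (R y) y = 0"
    "cinner (R z) z = complex_of_real ((\<Sum>u\<in>insert v V. t u) - t v) * \<alpha>"
    "{y, z} \<subseteq> cspan {x, v}" "{x, v} \<subseteq> cspan {y, z}"
    using rotate_zero_diagonal[OF R nx nv xv insert.prems(5) Rv t(2,1)] by blast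
  have orthV: "cinner a b = 0" if a: "a \<in> cspan {x, v}" and b: "b \<in> V" for a b
  proof (rule cspan_orthogonal[OF _ a complex_vector.span_base[OF b]])
    fix e f assume "e \<in> {x, v}" "f \<in> V"
    then have "e \<in> insert x (insert v V)" "f \<in> insert x (insert v V)" "e \<noteq> f"
      using insert.hyps(2) insert.prems(2) by auto
    then show "cinner e f = 0" using orthonormal_setD[OF on, of e f] by simp
  qed
  have zV: "cinner z b = 0" and yV: "cinner y b = 0" if "b \<in> V" for b
    using orthV[OF _ that] yz(6) by auto
  have "orthonormal_set V" by (rule orthonormal_set_subset[OF on]) auto
  then have "orthonormal_set (insert z V)" by (rule orthonormal_set_insert) (use yz zV in auto)
  moreover have "z \<notin> V" using zV[of z] yz(2) by auto
  moreover have "cinner (R z) z = complex_of_real (sum t V) * \<alpha>"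
    using yz(5) insert.hyps by simp
  ultimately obtain Y where Y: "orthonormal_set Y" "\<forall>y\<in>Y. cinner (R y) y = 0"
    "Y \<subseteq> cspan (insert z V)" "insert z V \<subseteq> cspan Y"
    using insert.IH[of z] insert.prems(3,4) by auto
  have yY: "cinner y b = 0" if "b \<in> Y" for b
  proof (rule cspan_orthogonal[OF _ complex_vector.span_base[of y "{y}"]])
    show "b \<in> cspan (insert z V)" using that Y(3) by blast
    show "cinner e f = 0" if "e \<in> {y}" "f \<in> insert z V" for e f using that yz(3) yV by auto
  qed simp
  have "orthonormal_set (insert y Y)" by (rule orthonormal_set_insert[OF Y(1) yz(1) yY])
  moreover have "insert y Y \<subseteq> cspan (insert x (insert v V))"
  proof -
    have 1: "{y, z} \<subseteq> cspan (insert x (insert v V))"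
      using yz(6) complex_vector.span_mono[of "{x, v}" "insert x (insert v V)"] by auto
    moreover have "V \<subseteq> cspan (insert x (insert v V))" by (auto intro: complex_vector.span_base)
    ultimately have "cspan (insert z V) \<subseteq> cspan (insert x (insert v V))" by (intro cspan_subset) auto
    with 1 Y(3) show ?thesis by auto
  qed
  moreover have "insert x (insert v V) \<subseteq> cspan (insert y Y)"
  proof -
    have 1: "cspan Y \<subseteq> cspan (insert y Y)" by (rule complex_vector.span_mono) auto
    then have "{y, z} \<subseteq> cspan (insert y Y)" using Y(4) by (auto intro: complex_vector.span_base)
    then have "cspan {y, z} \<subseteq> cspan (insert y Y)" by (rule cspan_subset)
    with yz(7) Y(4) 1 show ?thesis by auto
  qed
  ultimately show ?case using Y(2) yz(4) by (intro exI[of _ "insert y Y"]) simp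
qed

text \<open>Divergence lets the indices be cut into consecutive intervals of weight at least
  \<open>K\<close>; \<open>b j\<close> is the number of the interval containing \<open>j\<close>.
  The bound \<open>b j \<le> j\<close> is what later makes the diagonal recursion
  well-founded.\<close>

lemma divergent_blocks:
  fixes \<rho> :: "nat \<Rightarrow> real"
  assumes pos: "\<And>j. 0 < \<rho> j" and ns: "\<not> summable \<rho>"
  shows "\<exists>b :: nat \<Rightarrow> nat. (\<forall>j. b j \<le> j) \<and> (\<forall>n. finite {j. b j = n} \<and> K \<le> (\<Sum>j | b j = n. \<rho> j))"
proof -
  have ex: "\<exists>n>m. K \<le> (\<Sum>j\<in>{m..<n}. \<rho> j)" for m
  proof (rule ccontr)
    assume "\<not> ?thesis"
    then have lt: "(\<Sum>j\<in>{m..<n}. \<rho> j) < K" if "n > m" for n using that by force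
    have "(\<Sum>j\<le>n. \<rho> j) \<le> (\<Sum>j<m. \<rho> j) + K" for n
    proof -
      have "(\<Sum>j\<le>n. \<rho> j) \<le> (\<Sum>j\<in>{..<m} \<union> {m..<Suc (max m n)}. \<rho> j)"
        by (rule sum_mono2) (use pos in \<open>auto intro: less_imp_le\<close>)
      also have "\<dots> = (\<Sum>j<m. \<rho> j) + (\<Sum>j\<in>{m..<Suc (max m n)}. \<rho> j)"
        by (rule sum.union_disjoint) auto
      finally have "(\<Sum>j\<le>n. \<rho> j) \<le> (\<Sum>j<m. \<rho> j) + (\<Sum>j\<in>{m..<Suc (max m n)}. \<rho> j)" .
      moreover have "m < Suc (max m n)" by simp
      ultimately show ?thesis using lt[of "Suc (max m n)"] by linarith
    qed
    then have "summable \<rho>" using pos less_imp_le by (intro bounded_imp_summable) blast+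
    with ns show False by simp
  qed
  have "\<exists>m. \<forall>n. (n = 0 \<longrightarrow> m n = 0) \<and> (m n < m (Suc n) \<and> K \<le> (\<Sum>j\<in>{m n..<m (Suc n)}. \<rho> j))"
    by (rule dependent_nat_choice[where P = "\<lambda>n x. n = 0 \<longrightarrow> x = 0"
          and Q = "\<lambda>_ x y. x < y \<and> K \<le> (\<Sum>j\<in>{x..<y}. \<rho> j)"]) (use ex in auto)
  then obtain m :: "nat \<Rightarrow> nat" where m0: "m 0 = 0" and m1: "\<And>n. m n < m (Suc n)"
    and mK: "\<And>n. K \<le> (\<Sum>j\<in>{m n..<m (Suc n)}. \<rho> j)" by blast
  have sm: "strict_mono m" using m1 by (simp add: strict_mono_Suc_iff)
  have "\<exists>n. m n \<le> j \<and> j < m (Suc n)" for j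
  proof (induction j)
    case 0 show ?case using m0 m1[of 0] by (intro exI[of _ 0]) simp
  next
    case (Suc j)
    then obtain n where n: "m n \<le> j" "j < m (Suc n)" by blast
    show ?case
    proof (cases "Suc j < m (Suc n)")
      case True then show ?thesis using n by (intro exI[of _ n]) simp
    next
      case False
      then have "Suc j = m (Suc n)" using n by simp
      then show ?thesis using m1[of "Suc n"] by (intro exI[of _ "Suc n"]) simp
    qed
  qed
  then obtain b where b: "\<And>j. m (b j) \<le> j" "\<And>j. j < m (Suc (b j))" by metis
  have eq: "{j. b j = n} = {m n..<m (Suc n)}" for n
  proof (intro set_eqI iffI)
    fix j assume "j \<in> {j. b j = n}" then show "j \<in> {m n..<m (Suc n)}" using b[of j] by auto
  next
    fix j assume j: "j \<in> {m n..<m (Suc n)}"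
    have "m n < m (Suc (b j))" "m (b j) < m (Suc n)" using j b[of j] by auto
    then have "n < Suc (b j)" "b j < Suc n" using sm by (simp_all add: strict_mono_less)
    then show "j \<in> {j. b j = n}" by simp
  qed
  have "b j \<le> j" for j using b(1)[of j] strict_mono_imp_increasing[OF sm, of "b j"] by simp
  then show ?thesis using mK by (intro exI[of _ b]) (simp add: eq)
qed

text \<open>The value at \<open>2 * k + 1\<close> refers only to the earlier index
  \<open>b k \<le> k\<close>. This resolves the circularity that correcting the entry at
  \<open>v k\<close> changes the one at \<open>u k\<close>, which a later block must cancel.\<close>

lemma diagonal_recursion:
  fixes p q t :: "nat \<Rightarrow> complex"
  assumes "\<And>k. b k \<le> k"
  shows "\<exists>\<alpha>. (\<forall>k. \<alpha> (2 * k) = p k) \<and> (\<forall>k. \<alpha> (2 * k + 1) = q k + t k * \<alpha> (b k))"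
proof -
  define P where "P \<alpha> n y \<longleftrightarrow> y = (if even n then p (n div 2) else q (n div 2) + t (n div 2) * \<alpha> (b (n div 2)))"
    for \<alpha> :: "nat \<Rightarrow> complex" and n y
  have "\<exists>\<alpha>. \<forall>n. P \<alpha> n (\<alpha> n)"
  proof (rule dependent_wf_choice[where R = less_than])
    show "P \<alpha> n y = P \<beta> n y" if eq: "\<And>z. (z, n) \<in> less_than \<Longrightarrow> \<alpha> z = \<beta> z" for \<alpha> \<beta> n y
    proof (cases "even n")
      case False
      then have "n div 2 < n" by (metis div_less_dividend even_zero gr0I one_less_numeral_iff semiring_norm(76))
      then have "b (n div 2) < n" using assms[of "n div 2"] by simp
      then show ?thesis using eq by (simp add: P_def)
    qed (simp add: P_def)
    show "\<exists>y. P \<alpha> n y" for \<alpha> n by (simp add: P_def)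
  qed simp
  then obtain \<alpha> where \<alpha>: "\<And>n. P \<alpha> n (\<alpha> n)" by blast
  have "\<alpha> (2 * k) = p k" for k using \<alpha>[of "2 * k"] by (simp add: P_def)
  moreover have "\<alpha> (2 * k + 1) = q k + t k * \<alpha> (b k)" for k using \<alpha>[of "2 * k + 1"] by (simp add: P_def)
  ultimately show ?thesis by blast
qed

subsection \<open>The similarity\<close>

text \<open>The coefficients are absorbed into the vectors as \<open>c j / \<theta>\<close>, which
  leaves a contraction multiplied by \<theta>.\<close>

lemma diagonal_operator_scaled:
  fixes u v :: "nat \<Rightarrow> 'a::complex_hilbert_space"
  assumes u: "orthonormal_seq u" and v: "orthonormal_seq v" and c: "\<And>j. cmod (c j) \<le> \<theta>" and "0 < \<theta>"
  shows "\<exists>N. bounded_clinear N \<and> (\<forall>x. norm (N x) \<le> \<theta> * norm x) \<and>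
    (\<forall>x z. (\<lambda>j. c j * cinner x (v j) * cinner (u j) z) sums cinner (N x) z)"
proof -
  define h where "h j = (c j / complex_of_real \<theta>) *\<^sub>C u j" for j
  have h: "subnormal_seq h"
    using u orthonormal_seq_norm[OF u] c assms(4)
    by (simp add: subnormal_seq_def orthonormal_seq_def h_def cinner_linear norm_scaleC norm_divide)
  note D = diagonal_operator[OF orthonormal_imp_subnormal_seq[OF v] h]
  define N where "N x = complex_of_real \<theta> *\<^sub>C (\<Sum>k. cinner x (v k) *\<^sub>C h k)" for x
  have "bounded_clinear N" unfolding N_def[abs_def] by (rule bounded_clinear_scale[OF D(3)])
  moreover have "norm (N x) \<le> \<theta> * norm x" for x
    using D(2)[of x] assms(4) by (simp add: N_def norm_scaleC)
  moreover have "(\<lambda>j. c j * cinner x (v j) * cinner (u j) z) sums cinner (N x) z" for x z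
  proof -
    have "(\<lambda>j. cinner (complex_of_real \<theta> *\<^sub>C (cinner x (v j) *\<^sub>C h j)) z) sums cinner (N x) z"
      unfolding N_def by (intro bounded_linear.sums[OF cinner_bounded_linear_left]
          bounded_linear.sums[OF scaleC_bounded_linear] summable_sums D(1))
    moreover have "cinner (complex_of_real \<theta> *\<^sub>C (cinner x (v j) *\<^sub>C h j)) z
        = c j * cinner x (v j) * cinner (u j) z" for j
      using assms(4) by (simp add: h_def cinner_linear)
    ultimately show ?thesis by simp
  qed
  ultimately show ?thesis by blast
qed

text \<open>\<open>N\<close> maps into the closed span of the \<open>u j\<close> and depends only on
  the coefficients at the \<open>v j\<close>. Hence \<open>N\<close> squares to zero, and
  \<open>1 + N\<close> has inverse \<open>1 - N\<close>.\<close>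

lemma similarity_diagonal:
  fixes T :: "'a::complex_hilbert_space \<Rightarrow> 'a"
  assumes T: "bounded_clinear T" and u: "orthonormal_seq u" and v: "orthonormal_seq v"
    and uv: "\<And>i j. cinner (u i) (v j) = 0" and c: "\<And>j. cmod (c j) \<le> \<theta>" and "0 < \<theta>"
  shows "\<exists>S. bounded_clinear S \<and> bij S \<and> bounded_clinear (inv S) \<and>
    onorm S \<le> 1 + \<theta> \<and> onorm (inv S) \<le> 1 + \<theta> \<and>
    (\<forall>j. cinner ((inv S \<circ> T \<circ> S) (v j)) (v j) = cinner (T (v j)) (v j) + c j * cinner (T (u j)) (v j)) \<and>
    (\<forall>j. cinner ((inv S \<circ> T \<circ> S) (u j)) (u j) = cinner (T (u j)) (u j) - c j * cinner (T (u j)) (v j)) \<and>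
    (\<forall>w. (\<forall>j. cinner w (u j) = 0 \<and> cinner w (v j) = 0) \<longrightarrow>
      cinner ((inv S \<circ> T \<circ> S) w) w = cinner (T w) w)"
proof -
  obtain N where bN: "bounded_clinear N" and nN: "\<And>x. norm (N x) \<le> \<theta> * norm x"
    and cN: "\<And>x z. (\<lambda>j. c j * cinner x (v j) * cinner (u j) z) sums cinner (N x) z"
    using diagonal_operator_scaled[where c = c, OF u v c \<open>0 < \<theta>\<close>] by blast
  note linN = bounded_clinear_bounded_linear[OF bN]
  note linT = bounded_clinear_bounded_linear[OF T]
  have N0: "cinner (N x) z = 0" if "\<And>j. cinner x (v j) = 0 \<or> cinner (u j) z = 0" for x z
  proof -
    have "(\<lambda>j. c j * cinner x (v j) * cinner (u j) z) = (\<lambda>j. 0)" using that by auto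
    then show ?thesis using cN[of x z] sums_unique2[OF sums_zero] by metis
  qed
  have vu: "cinner (v i) (u j) = 0" for i j using uv cinner_eq_0_commute by blast
  have Nu: "cinner (N x) (u i) = c i * cinner x (v i)" for x i
  proof -
    have "(\<lambda>j. c j * cinner x (v j) * cinner (u j) (u i)) = (\<lambda>j. if j = i then c j * cinner x (v j) else 0)"
      using u by (auto simp: orthonormal_seq_def)
    then show ?thesis
      using cN[of x "u i"] sums_unique2[OF _ sums_single[of i "\<lambda>j. c j * cinner x (v j)"]] by simp
  qed
  have Nv: "N (v i) = c i *\<^sub>C u i" for i
  proof (rule cinner_eqI)
    fix z
    have "(\<lambda>j. c j * cinner (v i) (v j) * cinner (u j) z) = (\<lambda>j. if j = i then c j * cinner (u j) z else 0)"
      using v by (auto simp: orthonormal_seq_def)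
    then show "cinner (N (v i)) z = cinner (c i *\<^sub>C u i) z"
      using cN[of "v i" z] sums_unique2[OF _ sums_single[of i "\<lambda>j. c j * cinner (u j) z"]]
      by (simp add: cinner_scaleC_left)
  qed
  have N_ker: "N x = 0" if "\<And>j. cinner x (v j) = 0" for x
    using N0[of x "N x"] that by simp
  have NN: "N (N x) = 0" for x
  proof (rule N_ker)
    show "cinner (N x) (v j) = 0" for j by (rule N0) (simp add: uv)
  qed
  define S where "S x = x + N x" for x
  define S' where "S' x = x - N x" for x
  have SS': "S (S' x) = x" "S' (S x) = x" for x
    by (simp_all add: S_def S'_def linear_simps[OF linN] NN)
  have bS: "bounded_clinear S" "bounded_clinear S'"
    unfolding S_def[abs_def] S'_def[abs_def]
    by (intro bounded_clinear_add bounded_clinear_sub bounded_clinear_ident bN)+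
  have bij: "bij S" by (rule o_bij[of S']) (use SS' in auto)
  have inv: "inv S = S'" by (rule inv_equality) (use SS' in auto)
  have nS: "norm (S x) \<le> (1 + \<theta>) * norm x" "norm (S' x) \<le> (1 + \<theta>) * norm x" for x
    using norm_triangle_ineq[of x "N x"] norm_triangle_ineq4[of x "N x"] nN[of x]
    by (auto simp: S_def S'_def algebra_simps)
  have on: "onorm S \<le> 1 + \<theta>" "onorm S' \<le> 1 + \<theta>"
    using \<open>0 < \<theta>\<close> onorm_bound[OF _ nS(1)] onorm_bound[OF _ nS(2)] by auto
  have "cinner (S' (T (S (v j)))) (v j) = cinner (T (v j)) (v j) + c j * cinner (T (u j)) (v j)" for j
  proof -
    \<comment> \<open>At \<open>v j\<close> the left factor \<open>1 - N\<close> is invisible, and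
      only the right one acts.\<close>
    have "cinner (N y) (v j) = 0" for y by (rule N0) (simp add: uv)
    then show ?thesis
      by (simp add: S_def S'_def Nv linear_simps[OF linT] bounded_clinear_scaleC[OF T] cinner_linear)
  qed
  moreover have "cinner (S' (T (S (u j)))) (u j) = cinner (T (u j)) (u j) - c j * cinner (T (u j)) (v j)" for j
  proof -
    \<comment> \<open>At \<open>u j\<close> the right factor is trivial, and the left one subtracts
      \<open>c j\<close> times the component along \<open>v j\<close>.\<close>
    have "N (u j) = 0" by (rule N_ker) (rule uv)
    then show ?thesis by (simp add: S_def S'_def cinner_linear Nu)
  qed
  moreover have "cinner (S' (T (S w))) w = cinner (T w) w"
    if w: "\<forall>j. cinner w (u j) = 0 \<and> cinner w (v j) = 0" for w
  proof -
    have "N w = 0" by (rule N_ker) (use w in simp)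
    moreover have "cinner (N y) w = 0" for y by (rule N0) (use w cinner_eq_0_commute in blast)
    ultimately show ?thesis by (simp add: S_def S'_def cinner_linear)
  qed
  ultimately show ?thesis using bS bij on by (intro exI[of _ S]) (simp add: inv)
qed

subsection \<open>Choice of the blocks\<close>

lemma orthonormal_set_Un:
  assumes X: "orthonormal_set X" and Y: "orthonormal_set Y"
    and cross: "\<And>e f. e \<in> X \<Longrightarrow> f \<in> Y \<Longrightarrow> cinner e f = 0"
  shows "orthonormal_set (X \<union> Y)"
  unfolding orthonormal_set_def
proof (intro ballI)
  fix e f assume "e \<in> X \<union> Y" "f \<in> X \<union> Y"
  moreover have "a \<noteq> b" "b \<noteq> a" "cinner b a = 0" if "a \<in> X" "b \<in> Y" for a b
    using cross[OF that] orthonormal_setD[OF X that(1) that(1)] cinner_eq_0_commute[of a b] by auto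
  ultimately show "cinner e f = (if e = f then 1 else 0)"
    by (elim UnE) (simp_all add: orthonormal_setD[OF X] orthonormal_setD[OF Y] cross)
qed

text \<open>The sequence \<open>h\<close> only serves to make the remaining basis vectors infinite
  in number, so that they too form a sequence.\<close>

lemma orthonormal_basis_enumerate_rest:
  fixes u v h :: "nat \<Rightarrow> 'a::complex_hilbert_space"
  assumes sep: "separable_space (euclidean :: 'a topology)"
    and u: "orthonormal_seq u" and v: "orthonormal_seq v" and h: "orthonormal_seq h"
    and uv: "\<And>i j. cinner (u i) (v j) = 0" and uh: "\<And>i j. cinner (u i) (h j) = 0"
    and vh: "\<And>i j. cinner (v i) (h j) = 0"
  shows "\<exists>w. orthonormal_seq w \<and> (\<forall>i j. cinner (w i) (u j) = 0) \<and> (\<forall>i j. cinner (w i) (v j) = 0) \<and>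
    closure (cspan (range u \<union> range v \<union> range w)) = UNIV"
proof -
  have neq: "u i \<noteq> v j" "u i \<noteq> h j" "v i \<noteq> h j" for i j
    using uv[of i j] uh[of i j] vh[of i j] orthonormal_seq_norm[OF u, of i] orthonormal_seq_norm[OF v, of i]
    by force+
  have "orthonormal_set (range u \<union> range v \<union> range h)"
    by (intro orthonormal_set_Un orthonormal_seq_range u v h) (auto simp: uv uh vh)
  then obtain B where B: "range u \<union> range v \<union> range h \<subseteq> B" "orthonormal_basis B" "countable B"
    using orthonormal_basis_extend[OF sep] by blast
  note onB = orthonormal_setD[OF orthonormal_basis_set[OF B(2)]]
  define W where "W = B - range u - range v"
  have "h i \<in> W" for i
  proof -
    have "h i \<in> B" using B(1) by auto
    moreover have "h i \<notin> range u" "h i \<notin> range v" using neq(2)[of _ i] neq(3)[of _ i] by (metis rangeE)+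
    ultimately show ?thesis unfolding W_def by blast
  qed
  then have "range h \<subseteq> W" by (rule image_subsetI)
  then have "infinite W" using range_inj_infinite[OF orthonormal_seq_inj[OF h]] finite_subset by blast
  moreover have "countable W" using B(3) by (simp add: W_def)
  ultimately have bij: "bij_betw (from_nat_into W) UNIV W" by (intro bij_betw_from_nat_into)
  define w where "w = from_nat_into W"
  have w: "inj w" "range w = W" using bij by (auto simp: w_def bij_betw_def)
  have wB: "w i \<in> B" and wuv: "w i \<noteq> u j" "w i \<noteq> v j" for i j using w(2) unfolding W_def by auto
  have uB: "u j \<in> B" "v j \<in> B" for j using B(1) by auto
  have "orthonormal_seq w"
    using onB[OF wB wB] w(1) by (simp add: orthonormal_seq_def inj_eq)
  moreover have "cinner (w i) (u j) = 0" "cinner (w i) (v j) = 0" for i j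
    using onB[OF wB uB(1)] onB[OF wB uB(2)] wuv by simp_all
  moreover have "range u \<union> range v \<union> range w = B" using B(1) unfolding w(2) W_def by auto
  ultimately show ?thesis using B(2) by (intro exI[of _ w]) (simp add: orthonormal_basis_def)
qed

text \<open>Block \<open>n\<close> consists of \<open>x n\<close> and the \<open>v j\<close> with
  \<open>b j = n\<close>. The new vectors of a block span the same space as the old ones, so their
  union over all blocks is again an orthonormal basis.\<close>

lemma zero_diagonal_of_blocks:
  fixes R :: "'a::complex_inner \<Rightarrow> 'a"
  assumes R: "bounded_clinear R" and x: "orthonormal_seq x" and v: "orthonormal_seq v"
    and xv: "\<And>i j. cinner (x i) (v j) = 0"
    and dense: "closure (cspan (range x \<union> range v)) = UNIV"
    and fin: "\<And>n. finite {j. b j = n}" and t: "\<And>j. 0 \<le> t j" "\<And>n. (\<Sum>j | b j = n. t j) = (1 :: real)"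
    and Rx: "\<And>n. cinner (R (x n)) (x n) = \<alpha> n"
    and Rv: "\<And>j. cinner (R (v j)) (v j) = - complex_of_real (t j) * \<alpha> (b j)"
  shows "zero_diagonal R"
proof -
  define X where "X n = insert (x n) (v ` {j. b j = n})" for n :: nat
  have vx: "cinner (v i) (x j) = 0" for i j using xv cinner_eq_0_commute by blast
  have neq: "x i \<noteq> v j" for i j using xv[of i j] orthonormal_seq_norm[OF x, of i] by force
  have vinj: "v i = v j \<longleftrightarrow> i = j" for i j using orthonormal_seq_inj[OF v] by (simp add: inj_eq)
  have xx: "cinner (x i) (x j) = (if i = j then 1 else 0)" for i j using x by (simp add: orthonormal_seq_def)
  have vv: "cinner (v i) (v j) = (if i = j then 1 else 0)" for i j using v by (simp add: orthonormal_seq_def)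
  have onX: "orthonormal_set (X n)" for n
    using neq neq[symmetric] by (auto simp: orthonormal_set_def X_def xx vv xv vx vinj)
  have cross: "cinner e f = 0" if "e \<in> X m" "f \<in> X n" "m \<noteq> n" for e f m n
    using that by (auto simp: X_def xx vv xv vx)
  have "\<exists>Y. orthonormal_set Y \<and> (\<forall>y\<in>Y. cinner (R y) y = 0) \<and> Y \<subseteq> cspan (X n) \<and> X n \<subseteq> cspan Y" for n
    unfolding X_def
  \<comment> \<open>Weights are indexed by vectors there; \<open>the_inv v\<close> recovers the
    index.\<close>
  proof (rule block_zero_diagonal[OF R, where t = "\<lambda>y. t (the_inv v y)" and \<alpha> = "\<alpha> n"])
    have inv: "the_inv v (v j) = j" for j by (rule the_inv_f_f[OF orthonormal_seq_inj[OF v]])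
    show "finite (v ` {j. b j = n})" by (rule finite_imageI[OF fin])
    show "orthonormal_set (insert (x n) (v ` {j. b j = n}))" using onX by (simp add: X_def)
    show "x n \<notin> v ` {j. b j = n}" using neq by auto
    fix y assume "y \<in> v ` {j. b j = n}"
    then show "0 \<le> t (the_inv v y)" "cinner (R y) y = - complex_of_real (t (the_inv v y)) * \<alpha> n"
      using t(1) Rv by (auto simp: inv)
  next
    have inv: "the_inv v (v j) = j" for j by (rule the_inv_f_f[OF orthonormal_seq_inj[OF v]])
    have "(\<Sum>y\<in>v ` {j. b j = n}. t (the_inv v y)) = 1"
      using t(2)[of n] by (subst sum.reindex[OF inj_on_subset[OF orthonormal_seq_inj[OF v]]]) (auto simp: inv)
    then show "cinner (R (x n)) (x n) = complex_of_real (\<Sum>y\<in>v ` {j. b j = n}. t (the_inv v y)) * \<alpha> n"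
      by (simp add: Rx)
  qed
  then obtain Y where Y: "\<And>n. orthonormal_set (Y n)" "\<And>n y. y \<in> Y n \<Longrightarrow> cinner (R y) y = 0"
    "\<And>n. Y n \<subseteq> cspan (X n)" "\<And>n. X n \<subseteq> cspan (Y n)" by metis
  define B where "B = (\<Union>n. Y n)"
  have "orthonormal_set B"
    unfolding orthonormal_set_def
  proof (intro ballI)
    fix e f assume "e \<in> B" "f \<in> B"
    then obtain m n where mn: "e \<in> Y m" "f \<in> Y n" by (auto simp: B_def)
    show "cinner e f = (if e = f then 1 else 0)"
    proof (cases "m = n")
      case True then show ?thesis using mn orthonormal_setD[OF Y(1)] by blast
    next
      case False
      have "cinner e f = 0"
        by (rule cspan_orthogonal[OF cross subsetD[OF Y(3) mn(1)] subsetD[OF Y(3) mn(2)]]) (use False in auto)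
      moreover have "norm e = 1" using orthonormal_set_norm[OF Y(1) mn(1)] .
      ultimately show ?thesis by auto
    qed
  qed
  moreover have "closure (cspan B) = UNIV"
  proof -
    have "X n \<subseteq> cspan B" for n
      using Y(4)[of n] complex_vector.span_mono[of "Y n" B] by (auto simp: B_def)
    moreover have "range x \<union> range v \<subseteq> (\<Union>n. X n)" by (auto simp: X_def)
    ultimately have "cspan (range x \<union> range v) \<subseteq> cspan B" by (intro cspan_subset) blast
    then show ?thesis using closure_mono[of _ "cspan B"] dense by blast
  qed
  ultimately have "orthonormal_basis B" by (simp add: orthonormal_basis_def orthonormal_set_def)
  then show ?thesis using Y(2) by (auto simp: zero_diagonal_def B_def)
qed

section \<open>Coefficients of the similarity and assembly of the blocks\<close>

theorem theorem4p2:
  fixes T :: "'a::complex_hilbert_space \<Rightarrow> 'a" and \<theta> :: real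
  assumes separable: "separable_space (euclidean :: 'a topology)"
    and infinite_dim: "\<nexists>B :: 'a set. finite B \<and> cspan B = UNIV"
    and compact: "compact_operator T"
    and not_trace_class: "\<not> trace_class T"
    and theta: "0 < \<theta>" "\<theta> < 1"
  shows "\<exists>S :: 'a \<Rightarrow> 'a. bounded_clinear S \<and> bij S \<and> bounded_clinear (inv S) \<and>
    onorm S \<le> 1 + 2 * \<theta> \<and> onorm (inv S) \<le> 1 + 2 * \<theta> \<and>
    zero_diagonal (inv S \<circ> T \<circ> S)"
proof -
  have T: "seq_compact_map T" by (rule compact_operator_seq_compact[OF compact])
  have bT: "bounded_clinear T" by (rule seq_compact_map_bounded_clinear[OF T])
  obtain T' where T': "bounded_clinear T'" and adj: "is_adjoint T T'"
    by (rule adjoint_exists[OF separable bT])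
  obtain g and l :: "nat \<Rightarrow> real" where g: "orthonormal_seq g" "antimono (\<lambda>n. \<bar>l n\<bar>)"
    "\<not> summable (\<lambda>n. \<bar>l n\<bar>)" "\<And>n. \<bar>l n\<bar> \<le> 2 * cmod (cinner (T (g n)) (g n))"
    using not_trace_class_diagonal[OF separable infinite_dim T T' adj not_trace_class] by blast
  define a where "a v j = cinner (T (v j)) (v j)" for v :: "nat \<Rightarrow> 'a" and j
  define d where "d u v j = cinner (T (u j)) (v j)" for u v :: "nat \<Rightarrow> 'a" and j
  obtain u v h where u: "orthonormal_seq u" and v: "orthonormal_seq v" and h: "orthonormal_seq h"
    and uv: "\<And>i j. cinner (u i) (v j) = 0" and uh: "\<And>i j. cinner (u i) (h j) = 0"
    and vh: "\<And>i j. cinner (v i) (h j) = 0"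
    and pos: "\<And>j. 0 < \<theta> * cmod (d u v j) - cmod (a v j)"
    and ns: "\<not> summable (\<lambda>j. \<theta> * cmod (d u v j) - cmod (a v j))"
    using rotated_pairs_exist[OF T adj g theta] unfolding a_def d_def by blast
  obtain w where w: "orthonormal_seq w" and wu: "\<And>i j. cinner (w i) (u j) = 0"
    and wv: "\<And>i j. cinner (w i) (v j) = 0"
    and dense: "closure (cspan (range u \<union> range v \<union> range w)) = UNIV"
    using orthonormal_basis_enumerate_rest[OF separable u v h uv uh vh] by blast
  obtain M where M: "0 < M" "\<And>x. norm (T x) \<le> norm x * M"
    using bounded_linear.pos_bounded[OF bounded_clinear_bounded_linear[OF bT]] by blast
  have TM: "cmod (cinner (T y) z) \<le> M" if "norm y = 1" "norm z = 1" for y z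
    using norm_cinner_le[of "T y" z] M(2)[of y] that by simp
  \<comment> \<open>The radius of a disc of values around 0 that the entry at \<open>v j\<close> can
    be given with a coefficient of modulus at most \<theta>.\<close>
  define \<rho> where "\<rho> j = \<theta> * cmod (d u v j) - cmod (a v j)" for j
  have \<rho>: "0 < \<rho> j" "\<rho> j \<le> M" for j
  proof -
    have "cmod (d u v j) \<le> M"
      unfolding d_def by (rule TM) (use u v in \<open>simp_all add: orthonormal_seq_norm\<close>)
    moreover have "\<theta> * cmod (d u v j) \<le> 1 * cmod (d u v j)" using theta by (intro mult_right_mono) auto
    ultimately show "\<rho> j \<le> M" unfolding \<rho>_def using norm_ge_zero[of "a v j"] by linarith
    show "0 < \<rho> j" using pos by (simp add: \<rho>_def)
  qed
  \<comment> \<open>The weight \<open>3 * M\<close> anticipates the bound on \<alpha>: two diagonal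
    entries of \<open>T\<close> and one correction, each at most \<open>M\<close>.\<close>
  obtain b :: "nat \<Rightarrow> nat" where b: "\<And>j. b j \<le> j" "\<And>n. finite {j. b j = n}"
    "\<And>n. 3 * M \<le> (\<Sum>j | b j = n. \<rho> j)"
    using divergent_blocks[of \<rho> "3 * M"] \<rho>(1) ns unfolding \<rho>_def by blast
  define \<sigma> where "\<sigma> n = (\<Sum>j | b j = n. \<rho> j)" for n
  define t where "t j = \<rho> j / \<sigma> (b j)" for j
  have \<sigma>: "3 * M \<le> \<sigma> n" "0 < \<sigma> n" for n using b(3)[of n] M(1) by (auto simp: \<sigma>_def)
  have t: "0 \<le> t j" for j using \<rho>(1)[of j] \<sigma>(2)[of "b j"] by (simp add: t_def)
  have t1: "(\<Sum>j | b j = n. t j) = 1" for n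
  proof -
    have "(\<Sum>j | b j = n. t j) = (\<Sum>j | b j = n. \<rho> j / \<sigma> n)" by (rule sum.cong) (auto simp: t_def)
    also have "\<dots> = \<sigma> n / \<sigma> n" unfolding \<sigma>_def by (rule sum_divide_distrib[symmetric])
    finally show ?thesis using \<sigma>(2)[of n] by simp
  qed
  \<comment> \<open>\<alpha> prescribes the diagonal after conjugation: even indices belong to the
    unaffected \<open>w k\<close>, odd ones to \<open>u k\<close>, whose entry absorbs what is
    removed at \<open>v k\<close>.\<close>
  obtain \<alpha> where \<alpha>0: "\<And>k. \<alpha> (2 * k) = a w k"
    and \<alpha>1: "\<And>k. \<alpha> (2 * k + 1) = (a v k + a u k) + complex_of_real (t k) * \<alpha> (b k)"
    using diagonal_recursion[of b "a w" "\<lambda>k. a v k + a u k" "\<lambda>k. complex_of_real (t k)"] b(1) by blast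
  have aM: "cmod (a y j) \<le> M" if "orthonormal_seq y" for y j
    unfolding a_def by (rule TM) (use that in \<open>simp_all add: orthonormal_seq_norm\<close>)
  have t\<alpha>: "cmod (complex_of_real (t j) * \<alpha> (b j)) \<le> \<rho> j" if "cmod (\<alpha> (b j)) \<le> 3 * M" for j
  proof -
    have "cmod (complex_of_real (t j) * \<alpha> (b j)) = t j * cmod (\<alpha> (b j))" using t by (simp add: norm_mult)
    also have "\<dots> \<le> t j * \<sigma> (b j)" using that \<sigma>(1)[of "b j"] t by (intro mult_left_mono) auto
    also have "\<dots> = \<rho> j" using \<sigma>(2)[of "b j"] by (simp add: t_def)
    finally show ?thesis .
  qed
  \<comment> \<open>Strong induction, because the correction at \<open>2 * k + 1\<close> is bounded
    by \<open>\<rho> k \<le> M\<close> only once \<open>\<alpha> (b k)\<close> is.\<close>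
  have \<alpha>M: "cmod (\<alpha> n) \<le> 3 * M" for n
  proof (induction n rule: less_induct)
    case (less n)
    consider k where "n = 2 * k" | k where "n = 2 * k + 1" by (meson oddE evenE)
    then show ?case
    proof cases
      case 1
      then show ?thesis using \<alpha>0 aM[OF w, of k] M(1) by simp
    next
      case (2 k)
      have "b k < n" using b(1)[of k] 2 by simp
      then have "cmod (complex_of_real (t k) * \<alpha> (b k)) \<le> M"
        using t\<alpha>[OF less.IH] \<rho>(2)[of k] by force
      then show ?thesis
        unfolding 2 \<alpha>1 using aM[OF u, of k] aM[OF v, of k]
          norm_triangle_ineq[of "a v k + a u k" "complex_of_real (t k) * \<alpha> (b k)"]
          norm_triangle_ineq[of "a v k" "a u k"] by linarith
    qed
  qed
  \<comment> \<open>Solves for the coefficient that moves the entry at \<open>v j\<close> to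
    \<open>- t j\<close> times \<open>\<alpha> (b j)\<close>.\<close>
  define c where "c j = (- complex_of_real (t j) * \<alpha> (b j) - a v j) / d u v j" for j
  have d0: "0 < cmod (d u v j)" for j
  proof -
    have "0 < \<theta> * cmod (d u v j)" using pos[of j] norm_ge_zero[of "a v j"] by linarith
    then show ?thesis using theta(1) by (simp add: zero_less_mult_iff)
  qed
  have c: "cmod (c j) \<le> \<theta>" for j
  proof -
    have "cmod (- complex_of_real (t j) * \<alpha> (b j) - a v j) \<le> \<rho> j + cmod (a v j)"
      using norm_triangle_ineq4[of "- complex_of_real (t j) * \<alpha> (b j)" "a v j"] t\<alpha>[OF \<alpha>M, of j] by simp
    also have "\<dots> = \<theta> * cmod (d u v j)" by (simp add: \<rho>_def)
    finally show ?thesis using d0[of j] by (simp add: c_def norm_divide pos_divide_le_eq)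
  qed
  have cd: "c j * d u v j = - complex_of_real (t j) * \<alpha> (b j) - a v j" for j
    using d0[of j] by (simp add: c_def)
  obtain S where bS: "bounded_clinear S" and S: "bij S" "bounded_clinear (inv S)"
      "onorm S \<le> 1 + \<theta>" "onorm (inv S) \<le> 1 + \<theta>"
    and Rv: "\<And>j. cinner ((inv S \<circ> T \<circ> S) (v j)) (v j) = a v j + c j * d u v j"
    and Ru: "\<And>j. cinner ((inv S \<circ> T \<circ> S) (u j)) (u j) = a u j - c j * d u v j"
    and Rw: "\<And>z. (\<forall>j. cinner z (u j) = 0 \<and> cinner z (v j) = 0) \<Longrightarrow>
      cinner ((inv S \<circ> T \<circ> S) z) z = cinner (T z) z"
    using similarity_diagonal[where c = c, OF bT u v uv c theta(1)] unfolding a_def d_def by blast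
  \<comment> \<open>Interleaving \<open>w\<close> and \<open>u\<close> matches the even and odd
    indices of \<alpha>.\<close>
  define x where "x n = (if even n then w (n div 2) else u (n div 2))" for n
  have x_even: "x (2 * k) = w k" and x_odd: "x (2 * k + 1) = u k" for k by (simp_all add: x_def)
  have uw: "cinner (u i) (w j) = 0" for i j using wu cinner_eq_0_commute by blast
  have x: "orthonormal_seq x"
    unfolding orthonormal_seq_def
  proof (intro allI)
    fix m n
    show "cinner (x m) (x n) = (if m = n then 1 else 0)"
      using u w wu uw by (auto simp: orthonormal_seq_def x_def elim!: evenE oddE)
  qed
  have xv: "cinner (x i) (v j) = 0" for i j using wv uv by (simp add: x_def)
  have dense_x: "closure (cspan (range x \<union> range v)) = UNIV"
  proof -
    have "range u \<union> range v \<union> range w \<subseteq> range x \<union> range v"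
      using x_even x_odd by (auto simp flip: x_even x_odd)
    then show ?thesis using dense closure_mono[OF complex_vector.span_mono] by blast
  qed
  have Rx: "cinner ((inv S \<circ> T \<circ> S) (x n)) (x n) = \<alpha> n" for n
  proof -
    consider k where "n = 2 * k" | k where "n = 2 * k + 1" by (meson oddE evenE)
    then show ?thesis
    proof cases
      case 1
      have "cinner ((inv S \<circ> T \<circ> S) (w k)) (w k) = cinner (T (w k)) (w k)"
        by (rule Rw) (use wu wv in simp)
      then show ?thesis unfolding 1 x_even \<alpha>0 a_def .
    next
      case (2 k)
      show ?thesis unfolding 2 x_odd \<alpha>1 Ru cd by simp
    qed
  qed
  have Rv': "cinner ((inv S \<circ> T \<circ> S) (v j)) (v j) = - complex_of_real (t j) * \<alpha> (b j)" for j
    unfolding Rv cd by simp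
  have bR: "bounded_clinear (inv S \<circ> T \<circ> S)"
    unfolding o_def by (rule bounded_clinear_compose[OF S(2) bounded_clinear_compose[OF bT bS]])
  have "zero_diagonal (inv S \<circ> T \<circ> S)"
    by (rule zero_diagonal_of_blocks[where t = t, OF bR x v xv dense_x b(2) t t1 Rx Rv'])
  then show ?thesis using bS S theta(1) by (intro exI[of _ S]) auto
qed

end
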